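(* Let $A$ be a nonnegative integer-valued random variable and let $\{B_i\}_{i\ge1}$ be i.i.d. nonnegative integer-valued random variables with the law of a random variable $B$, with $A$ and $\{B_i\}_{i\ge1}$ independent. Assume: (1) $\mathbb P(A>x)\sim(1+x)^{-1}$ as $x\to\infty$; (2) $\mathbb P(B>x)=\dfrac{L(x)}{1+x}$, where $L$ is slowly varying at infinity and $L(x)\sim(\log x)^{-1-\varepsilon}$ as $x\to\infty$ for some $\varepsilon>0$; (3) $b:=\mathbb E[B]\in(0,1)$. Let $X$ be the stationary solution of the fixed-point equation $$X\stackrel{d}{=}A+\sum_{i=1}^{X}B_i .$$ Then, as $x\to\infty$, $$\mathbb P(X>x)\ \sim\ \frac{1}{(1-b)(1+x)}+\Big(\sum_{n\ge1}n\,b^{\,n-1}\log(x\,b^{-n})\Big)\frac{L(x)}{1+x}\,(1+o(1)).$$ In particular, $$\mathbb P(X>x)\sim\frac{1}{(1-b)(1+x)},$$ and the second-order correction term $\Big(\sum_{n\ge1}n\,b^{\,n-1}\log(x\,b^{-n})\Big)\frac{L(x)}{1+x}$ is of order $\frac{L(x)\log x}{1+x}$ (that is, $\Theta\big(\frac{L(x)\log x}{1+x}\big)$), where $\frac{L(x)\log x}{1+x}=o\big(\frac1{1+x}\big)$.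
   Context: $\stackrel{d}{=}$ denotes equality in distribution; $f(x)\sim g(x)$ means $f(x)/g(x)\to1$ as $x\to\infty$. A measurable $L:(0,\infty)\to(0,\infty)$ is slowly varying if $L(tx)/L(x)\to1$ as $x\to\infty$ for each $t>0$. The stationary solution $X$ is a (finite) nonnegative integer-valued random variable such that, when $X$, $A$ and $\{B_i\}_{i\ge1}$ are taken independent on the right-hand side, $A+\sum_{i=1}^X B_i$ has the same distribution as $X$. *)

theory Defs
  imports "HOL-Probability.Probability" "HOL-Library.Landau_Symbols"
begin

text \<open>Functions on $(0,\infty)$ are represented by functions on all reals; no condition is imposed
  outside $(0,\infty)$.\<close>

definition slowly_varying :: "(real \<Rightarrow> real) \<Rightarrow> bool" where
  "slowly_varying L \<longleftrightarrow>
     L \<in> borel_measurable (restrict_space borel {0<..}) \<and>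
     (\<forall>x>0. L x > 0) \<and>
     (\<forall>t>0. ((\<lambda>x. L (t * x) / L x) \<longlongrightarrow> 1) at_top)"

text \<open>The variables $A$ and $B_i$ live on \<open>M\<close>, while $X$ may live on any probability space
  \<open>N\<close>. The right-hand side of the fixed-point equation is formed on the product space, which is
  what makes $X$ independent of $(A, B_1, B_2, \ldots)$ there. The sequence \<open>B\<close> is
  indexed from 0.\<close>

definition stationary_solution ::
    "'a measure \<Rightarrow> ('a \<Rightarrow> nat) \<Rightarrow> (nat \<Rightarrow> 'a \<Rightarrow> nat) \<Rightarrow> 'b measure \<Rightarrow> ('b \<Rightarrow> nat) \<Rightarrow> bool" where
  "stationary_solution M A B N X \<longleftrightarrow>
     prob_space N \<and> X \<in> measurable N (count_space UNIV) \<and>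
     distr N (count_space UNIV) X =
       distr (N \<Otimes>\<^sub>M M) (count_space UNIV) (\<lambda>(\<eta>, \<omega>). A \<omega> + (\<Sum>i<X \<eta>. B i \<omega>))"

definition correction_term :: "real \<Rightarrow> (real \<Rightarrow> real) \<Rightarrow> real \<Rightarrow> real" where
  "correction_term b L x =
     (\<Sum>\<^sub>\<infinity>n\<in>{1::nat..}. real n * b ^ (n - 1) * ln (x * b powi (- int n))) * (L x / (1 + x))"

end

theory Submission
  imports Defs "HOL-Real_Asymp.Real_Asymp"
begin

text \<open>The generating functions satisfy \<open>F\<^sub>X s = F\<^sub>A s * F\<^sub>X (f s)\<close> with \<open>f = F\<^sub>B\<close>. Hence the
  logarithmic derivative \<open>G = F\<^sub>X' / F\<^sub>X\<close> satisfies \<open>G s = G\<^sub>A s + f' s * G (f s)\<close>, and \<open>f\<close>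
  contracts towards 1 at rate \<open>b\<close>. Iterating first gives \<open>G s = O(ln (1 / (1 - s)))\<close>. The same
  recursion for \<open>(1 - s) * G' s\<close> then has source term \<open>(1 - s) * G\<^sub>A' s\<close>, which tends to 1, plus
  \<open>(1 - s) * f'' s * G (f s)\<close>, which vanishes because \<open>L x * ln x\<close> does, and a multiplier tending
  to \<open>b\<close>; so \<open>(1 - s) * F\<^sub>X'' s\<close> tends to \<open>1 / (1 - b)\<close>. Working with second derivatives is what makes
  Karamata's Tauberian theorem recover the tail itself at the critical index 1. The correction term
  is of smaller order than the leading one, so \<open>r = 0\<close> is a valid choice in the expansion.\<close>

section \<open>Power series on the unit interval and Abelian means\<close>

text \<open>No tail or moment of \<open>X\<close> is known in advance. All that the iteration may
  use are \<open>(1 - s) * G s -> 0\<close> and \<open>(1 - s)^2 * G' s -> 0\<close>, which hold for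
  every probability law on the naturals. They suffice because the law of \<open>B\<close> satisfies
  \<open>f' s <= (1 - f s) / (1 - s)\<close>: along an orbit of \<open>f\<close> the product of the
  multipliers is bounded by a telescoping quotient, whose numerator is the factor that those limits
  require. For \<open>(1 - s) * G'\<close> the multiplier is
  \<open>f'^2 * (1 - s) / (1 - f s)\<close>, with limit \<open>b^2 / b = b\<close>; a source tending
  to 1 then forces the limit \<open>1 / (1 - b)\<close>. The logarithmic bound on \<open>G\<close>
  has to precede this, because \<open>f''\<close> is unbounded near 1 and multiplies
  \<open>G (f s)\<close> in the source. The tail series \<open>Q = (1 - F) / (1 - s)\<close>
  accompanies \<open>F\<close> throughout, since the coefficients of its derivative are
  \<open>(n + 1) * tail (n + 1)\<close>, the quantities whose limit is wanted.\<close>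

definition unit_summable :: "(nat \<Rightarrow> real) \<Rightarrow> bool" where
  "unit_summable a \<longleftrightarrow> (\<forall>x. \<bar>x\<bar> < 1 \<longrightarrow> summable (\<lambda>n. a n * x ^ n))"

definition gf :: "(nat \<Rightarrow> real) \<Rightarrow> real \<Rightarrow> real" where
  "gf a x = (\<Sum>n. a n * x ^ n)"

lemma unit_summableD: "unit_summable a \<Longrightarrow> \<bar>x\<bar> < 1 \<Longrightarrow> summable (\<lambda>n. a n * x ^ n)"
  by (simp add: unit_summable_def)

lemma diffs_nonneg: "(\<And>n. 0 \<le> a n) \<Longrightarrow> 0 \<le> diffs a n" for a :: "nat \<Rightarrow> real"
  by (simp add: diffs_def)

lemma unit_summable_diffs: "unit_summable a \<Longrightarrow> unit_summable (diffs a)"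
  unfolding unit_summable_def by (metis real_norm_def termdiff_converges)

lemma unit_summable_le:
  assumes "unit_summable a" "\<And>n. \<bar>b n\<bar> \<le> a n"
  shows "unit_summable b"
  unfolding unit_summable_def
proof (intro allI impI)
  fix x :: real assume x: "\<bar>x\<bar> < 1"
  have "norm (b n * x ^ n) \<le> a n * \<bar>x\<bar> ^ n" for n
    using assms(2)[of n] by (simp add: abs_mult power_abs mult_right_mono)
  then show "summable (\<lambda>n. b n * x ^ n)"
    by (intro summable_comparison_test'[OF unit_summableD[OF assms(1), of "\<bar>x\<bar>"], of 0]) (use x in auto)
qed

lemma unit_summable_bounded:
  assumes "\<And>n. \<bar>a n\<bar> \<le> C"
  shows "unit_summable a"
proof (rule unit_summable_le[OF _ assms])
  show "unit_summable (\<lambda>_. C)"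
    unfolding unit_summable_def by (auto intro: summable_mult summable_geometric)
qed

lemma unit_summable_convergent:
  assumes "a \<longlonglongrightarrow> l"
  shows "unit_summable a"
proof -
  have "Bseq a" using assms by (simp add: convergentI Cauchy_Bseq convergent_Cauchy)
  then obtain C where "\<And>n. norm (a n) \<le> C" unfolding Bseq_def by auto
  then show ?thesis by (intro unit_summable_bounded[of a C]) simp
qed

lemma unit_summable_mult: "unit_summable a \<Longrightarrow> unit_summable (\<lambda>n. c * a n)"
  unfolding unit_summable_def using summable_mult by (fastforce simp: mult.assoc)

lemma unit_summable_weighted:
  assumes "unit_summable w" "\<And>n. 0 \<le> w n" "Bseq a"
  shows "unit_summable (\<lambda>n. w n * a n)"
proof -
  obtain C where C: "\<And>n. norm (a n) \<le> C" using assms(3) unfolding Bseq_def by auto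
  show ?thesis
  proof (rule unit_summable_le[OF unit_summable_mult[OF assms(1), of C]])
    fix n show "\<bar>w n * a n\<bar> \<le> C * w n"
      using mult_right_mono[OF C[of n], of "w n"] assms(2)[of n] by (simp add: abs_mult mult.commute)
  qed
qed

lemma gf_has_derivative:
  assumes "unit_summable a" "\<bar>x\<bar> < 1"
  shows "(gf a has_real_derivative gf (diffs a) x) (at x)"
proof -
  have "((\<lambda>x. \<Sum>n. a n * x ^ n) has_real_derivative (\<Sum>n. diffs a n * x ^ n)) (at x)"
    by (rule termdiffs_strong'[of 1]) (use assms in \<open>auto simp: unit_summable_def\<close>)
  then show ?thesis by (simp add: gf_def[abs_def])
qed

lemma gf_nonneg:
  assumes "unit_summable a" "\<And>n. 0 \<le> a n" "0 \<le> x" "x < 1"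
  shows "0 \<le> gf a x"
  unfolding gf_def using assms by (intro suminf_nonneg unit_summableD) auto

lemma gf_mono:
  assumes "unit_summable a" "unit_summable b" "\<And>n. a n \<le> b n" "0 \<le> x" "x < 1"
  shows "gf a x \<le> gf b x"
  unfolding gf_def using assms by (intro suminf_le unit_summableD mult_right_mono) auto

lemma gf_mult: "unit_summable a \<Longrightarrow> \<bar>x\<bar> < 1 \<Longrightarrow> gf (\<lambda>n. c * a n) x = c * gf a x"
  unfolding gf_def using suminf_mult[OF unit_summableD, of a x c] by (simp add: mult.assoc)

lemma gf_add:
  assumes "unit_summable a" "unit_summable b" "\<bar>x\<bar> < 1"
  shows "gf (\<lambda>n. a n + b n) x = gf a x + gf b x"
  unfolding gf_def using suminf_add[OF unit_summableD unit_summableD, of a x b x] assms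
  by (simp add: algebra_simps)

lemma unit_summable_add: "unit_summable a \<Longrightarrow> unit_summable b \<Longrightarrow> unit_summable (\<lambda>n. a n + b n)"
  unfolding unit_summable_def using summable_add by (fastforce simp: algebra_simps)

lemma gf_diff:
  assumes "unit_summable a" "unit_summable b" "\<bar>x\<bar> < 1"
  shows "gf (\<lambda>n. a n - b n) x = gf a x - gf b x"
  unfolding gf_def using suminf_diff[OF unit_summableD unit_summableD, of a x b x] assms
  by (simp add: algebra_simps)

lemma gf_abs_le:
  assumes "unit_summable b" "\<And>n. \<bar>a n\<bar> \<le> b n" "0 \<le> x" "x < 1"
  shows "\<bar>gf a x\<bar> \<le> gf b x"
proof -
  have a: "unit_summable a" by (rule unit_summable_le[OF assms(1,2)])
  have "gf a x \<le> gf b x"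
    using assms a by (intro gf_mono) (auto intro: order_trans[OF abs_ge_self])
  moreover have "gf (\<lambda>n. -1 * a n) x \<le> gf b x"
    using assms a by (intro gf_mono unit_summable_mult) (auto intro: order_trans[OF abs_ge_minus_self])
  ultimately show ?thesis using gf_mult[OF a, of x "-1"] assms by auto
qed

lemma eventually_at_left_one: "eventually (\<lambda>s::real. 0 < s \<and> s < 1) (at_left 1)"
  using eventually_at_left_real[of 0 "1::real"] by auto

lemma gf_one: "\<bar>x\<bar> < 1 \<Longrightarrow> gf (\<lambda>_. 1) x = 1 / (1 - x)"
  unfolding gf_def by (simp add: suminf_geometric)

lemma gf_Suc: "\<bar>x\<bar> < 1 \<Longrightarrow> gf (\<lambda>n. real (Suc n)) x = 1 / (1 - x)\<^sup>2"
  unfolding gf_def using geometric_deriv_sums[of x] by (auto dest: sums_unique)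

lemma unit_summable_one: "unit_summable (\<lambda>_. 1)"
  by (rule unit_summable_bounded[of _ 1]) auto

lemma unit_summable_Suc: "unit_summable (\<lambda>n. real (Suc n))"
  using unit_summable_diffs[OF unit_summable_one] by (simp add: diffs_def)

text \<open>Regularity of a positive summation method: the finitely many \<open>a n\<close> that are
  still far from \<open>l\<close> contribute a bounded amount, negligible against the divergent
  \<open>gf w\<close>, and the others are averaged with nonnegative weights.\<close>

lemma weighted_abel_mean:
  assumes w: "unit_summable w" "\<And>n. 0 \<le> w n"
    and winf: "filterlim (gf w) at_top (at_left 1)"
    and a: "a \<longlonglongrightarrow> l"
  shows "((\<lambda>s. gf (\<lambda>n. w n * a n) s / gf w s) \<longlongrightarrow> l) (at_left 1)"
proof (rule tendstoI)
  fix e :: real assume e: "e > 0"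
  have "eventually (\<lambda>n. \<bar>a n - l\<bar> < e/2) sequentially"
    using tendstoD[OF a, of "e/2"] e by (simp add: dist_real_def)
  then obtain m where m: "\<And>n. n \<ge> m \<Longrightarrow> \<bar>a n - l\<bar> < e/2" by (auto simp: eventually_sequentially)
  have ba: "Bseq a" using a by (simp add: convergentI Cauchy_Bseq convergent_Cauchy)
  \<comment> \<open>\<open>c\<close> carries the error of the indices below \<open>m\<close>, and
    \<open>K\<close> bounds its generating function uniformly on the unit interval.\<close>
  define K where "K = (\<Sum>n<m. w n * \<bar>a n - l\<bar>)"
  define c where "c n = (if n < m then w n * \<bar>a n - l\<bar> else 0)" for n
  have c_sums: "(\<lambda>n. c n * x ^ n) sums (\<Sum>n<m. c n * x ^ n)" for x
    by (rule sums_finite) (auto simp: c_def)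
  have c_us: "unit_summable c" using c_sums by (auto simp: unit_summable_def sums_iff)
  have gfc: "gf c s \<le> K" if "0 \<le> s" "s < 1" for s
  proof -
    have "gf c s = (\<Sum>n<m. c n * s ^ n)" using c_sums by (simp add: gf_def sums_iff)
    also have "\<dots> \<le> (\<Sum>n<m. c n)"
      using that w by (intro sum_mono mult_left_le power_le_one) (auto simp: c_def)
    also have "\<dots> = K" by (auto simp: K_def c_def)
    finally show ?thesis .
  qed
  \<comment> \<open>This threshold gives \<open>K < e/2 * gf w s\<close>, so the early indices cost
    less than half of the tolerance.\<close>
  have "eventually (\<lambda>s. gf w s > 2 * K / e + 1) (at_left 1)"
    using winf by (simp add: filterlim_at_top_dense)
  moreover have "eventually (\<lambda>s. gf w s > 0) (at_left 1)"
    using winf by (simp add: filterlim_at_top_dense)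
  ultimately show "eventually (\<lambda>s. dist (gf (\<lambda>n. w n * a n) s / gf w s) l < e) (at_left 1)"
    using eventually_at_left_one
  proof eventually_elim
    case (elim s)
    then have s: "0 \<le> s" "s < 1" "\<bar>s\<bar> < 1" by auto
    have "\<bar>gf (\<lambda>n. w n * a n) s - l * gf w s\<bar> = \<bar>gf (\<lambda>n. w n * (a n - l)) s\<bar>"
      using s gf_diff[OF unit_summable_weighted[OF w ba] unit_summable_mult[OF w(1), of l], of s]
      by (simp add: gf_mult[OF w(1)] algebra_simps)
    also have "\<dots> \<le> gf (\<lambda>n. e/2 * w n + c n) s"
    proof (rule gf_abs_le)
      show "unit_summable (\<lambda>n. e/2 * w n + c n)"
        by (intro unit_summable_add unit_summable_mult w c_us)
      fix n
      have "w n * \<bar>a n - l\<bar> \<le> w n * (e/2)" if "n \<ge> m"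
        using m[OF that] w(2)[of n] by (intro mult_left_mono) auto
      then show "\<bar>w n * (a n - l)\<bar> \<le> e/2 * w n + c n"
        using w(2)[of n] e by (auto simp: c_def abs_mult mult.commute)
    qed (use s in auto)
    also have "\<dots> = e/2 * gf w s + gf c s"
      using s gf_add[OF unit_summable_mult[OF w(1), of "e/2"] c_us, of s] gf_mult[OF w(1), of s
          "e/2"] by simp
    also have "\<dots> \<le> e/2 * gf w s + K" using gfc s by auto
    also have "\<dots> < e * gf w s" using elim e by (simp add: field_simps)
    finally have "\<bar>gf (\<lambda>n. w n * a n) s - l * gf w s\<bar> < e * gf w s" .
    moreover have "gf (\<lambda>n. w n * a n) s / gf w s - l = (gf (\<lambda>n. w n * a n) s - l * gf w s) / gf w s"
      using elim by (simp add: field_simps)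
    ultimately show ?case using elim by (simp add: dist_real_def abs_divide pos_divide_less_eq)
  qed
qed

lemma filterlim_inverse_one_minus: "filterlim (\<lambda>s::real. 1 / (1 - s)) at_top (at_left 1)"
  by real_asymp

lemma abel_mean:
  assumes "a \<longlonglongrightarrow> l"
  shows "((\<lambda>s. (1 - s) * gf a s) \<longlongrightarrow> l) (at_left 1)"
proof -
  have "filterlim (gf (\<lambda>_. 1)) at_top (at_left 1)"
    by (rule filterlim_mono_eventually[OF filterlim_inverse_one_minus order_refl order_refl])
      (use eventually_at_left_one in eventually_elim, auto simp: gf_one)
  from weighted_abel_mean[OF unit_summable_one _ this assms]
  have "((\<lambda>s. gf a s / gf (\<lambda>_. 1) s) \<longlongrightarrow> l) (at_left 1)" by simp
  then show ?thesis
    by (rule Lim_transform_eventually)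
      (use eventually_at_left_one in eventually_elim, auto simp: gf_one)
qed

text \<open>The weights \<open>n + 1\<close> have generating function \<open>1 / (1 - s)^2\<close>;
  this version serves coefficients produced by one more differentiation.\<close>

lemma abel_mean_Suc:
  assumes "a \<longlonglongrightarrow> l"
  shows "((\<lambda>s. (1 - s)\<^sup>2 * gf (\<lambda>n. real (Suc n) * a n) s) \<longlongrightarrow> l) (at_left 1)"
proof -
  have "filterlim (\<lambda>s::real. 1 / (1 - s)\<^sup>2) at_top (at_left 1)" by real_asymp
  then have "filterlim (gf (\<lambda>n. real (Suc n))) at_top (at_left 1)"
    by (rule filterlim_mono_eventually[OF _ order_refl order_refl])
      (use eventually_at_left_one in eventually_elim, auto simp: gf_Suc simp del: of_nat_Suc)
  from weighted_abel_mean[OF unit_summable_Suc _ this assms]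
  have "((\<lambda>s. gf (\<lambda>n. real (Suc n) * a n) s / gf (\<lambda>n. real (Suc n)) s) \<longlongrightarrow> l) (at_left 1)" by simp
  then show ?thesis
    by (rule Lim_transform_eventually)
      (use eventually_at_left_one in eventually_elim, auto simp: gf_Suc simp del: of_nat_Suc)
qed

section \<open>Generating functions of tails\<close>

locale prob_seq =
  fixes p :: "nat \<Rightarrow> real"
  assumes nonneg: "0 \<le> p n" and sums_1: "p sums 1"
begin

text \<open>The probability of exceeding \<open>n\<close> strictly. With this convention the tails
  summed from index 0 give the mean.\<close>

definition tail :: "nat \<Rightarrow> real" where "tail n = 1 - (\<Sum>k\<le>n. p k)"

lemma tail_0: "tail 0 = 1 - p 0" and tail_Suc: "tail (Suc n) = tail n - p (Suc n)"
  by (simp_all add: tail_def)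

lemma decseq_tail: "decseq tail"
  by (rule decseq_SucI) (simp add: tail_Suc nonneg)

lemma tail_tendsto_0: "tail \<longlonglongrightarrow> 0"
  unfolding tail_def using tendsto_diff[OF tendsto_const[of 1] sums_1[unfolded sums_def_le]] by simp

lemma tail_nonneg: "0 \<le> tail n"
  by (rule decseq_ge[OF decseq_tail tail_tendsto_0])

lemma tail_le_1: "tail n \<le> 1"
  unfolding tail_def by (simp add: sum_nonneg nonneg)

lemma p_le_1: "p n \<le> 1"
  using tail_nonneg[of n] nonneg sum_nonneg[of "{..<n}" p]
  by (auto simp: tail_def lessThan_Suc_atMost[symmetric])

lemma unit_summable_p: "unit_summable p"
  by (rule unit_summable_bounded[of _ 1]) (simp add: nonneg p_le_1)

lemma unit_summable_tail: "unit_summable tail"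
  by (rule unit_summable_bounded[of _ 1]) (simp add: tail_nonneg tail_le_1)

abbreviation "Q \<equiv> gf tail"
abbreviation "Q' \<equiv> gf (diffs tail)"
abbreviation "Q'' \<equiv> gf (diffs (diffs tail))"
abbreviation "F \<equiv> gf p"
abbreviation "F' \<equiv> gf (diffs p)"
abbreviation "F'' \<equiv> gf (diffs (diffs p))"

lemmas unit_summables = unit_summable_p unit_summable_tail unit_summable_diffs[OF unit_summable_p]
    unit_summable_diffs[OF unit_summable_tail]
  unit_summable_diffs[OF unit_summable_diffs[OF unit_summable_p]]
  unit_summable_diffs[OF unit_summable_diffs[OF unit_summable_tail]]

text \<open>Summation by parts: \<open>p (Suc n) = tail n - tail (Suc n)\<close>, so multiplying
  \<open>Q\<close> by \<open>1 - s\<close> recovers the coefficients of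
  \<open>1 - F\<close>.\<close>

lemma F_eq: "\<bar>s\<bar> < 1 \<Longrightarrow> F s = 1 - (1 - s) * Q s"
proof -
  assume s: "\<bar>s\<bar> < 1"
  have 1: "(\<lambda>n. tail n * s ^ n) sums Q s" and 2: "(\<lambda>n. p n * s ^ n) sums F s"
    using s unit_summable_p unit_summable_tail by (auto simp: gf_def unit_summable_def summable_sums)
  have "(\<lambda>n. tail (Suc n) * s ^ Suc n) sums (Q s - tail 0)"
    using 1 by (subst sums_Suc_iff) simp
  moreover have "(\<lambda>n. s * (tail n * s ^ n)) sums (s * Q s)" by (rule sums_mult[OF 1])
  ultimately have "(\<lambda>n. s * (tail n * s ^ n) - tail (Suc n) * s ^ Suc n) sums (s * Q s - (Q s - tail 0))"
    by (rule sums_diff[rotated])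
  moreover have "s * (tail n * s ^ n) - tail (Suc n) * s ^ Suc n = p (Suc n) * s ^ Suc n" for n
    by (simp add: tail_Suc algebra_simps)
  ultimately have "(\<lambda>n. p (Suc n) * s ^ Suc n) sums (s * Q s - (Q s - tail 0))" by simp
  then have "(\<lambda>n. p n * s ^ n) sums (s * Q s - (Q s - tail 0) + p 0)"
    by (subst (asm) sums_Suc_iff) simp
  with 2 show "F s = 1 - (1 - s) * Q s" by (auto dest: sums_unique2 simp: tail_0 algebra_simps)
qed

lemma F_deriv: "\<bar>s\<bar> < 1 \<Longrightarrow> (F has_real_derivative F' s) (at s)"
  and F'_deriv: "\<bar>s\<bar> < 1 \<Longrightarrow> (F' has_real_derivative F'' s) (at s)"
  and Q_deriv: "\<bar>s\<bar> < 1 \<Longrightarrow> (Q has_real_derivative Q' s) (at s)"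
  and Q'_deriv: "\<bar>s\<bar> < 1 \<Longrightarrow> (Q' has_real_derivative Q'' s) (at s)"
  using unit_summables by (auto intro: gf_has_derivative)

lemma eventually_nhds_unit: "\<bar>s\<bar> < 1 \<Longrightarrow> eventually (\<lambda>x::real. \<bar>x\<bar> < 1) (nhds s)"
  by (rule eventually_nhds_in_open[of "{x. \<bar>x\<bar> < 1}" s, simplified]) (auto intro!: open_Collect_less
      continuous_intros)

text \<open>Obtained by differentiating the identity for \<open>F\<close>, and once more for
  \<open>F''\<close>. On the unit interval the subtracted terms are nonnegative, which yields the
  majorants \<open>Q\<close> and \<open>2 * Q'\<close>; the exact forms are needed for
  limits.\<close>

lemma F'_eq: assumes s: "\<bar>s\<bar> < 1" shows "F' s = Q s - (1 - s) * Q' s"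
proof -
  have "((\<lambda>s. 1 - (1 - s) * Q s) has_real_derivative (Q s - (1 - s) * Q' s)) (at s)"
    using s by (auto intro!: derivative_eq_intros Q_deriv)
  moreover have "eventually (\<lambda>x. F x = 1 - (1 - x) * Q x) (nhds s)"
    using eventually_nhds_unit[OF s] by eventually_elim (rule F_eq)
  ultimately have "(F has_real_derivative (Q s - (1 - s) * Q' s)) (at s)"
    by (subst DERIV_cong_ev[OF refl _ refl])
  with F_deriv[OF s] show ?thesis by (rule DERIV_unique)
qed

lemma F''_eq: assumes s: "\<bar>s\<bar> < 1" shows "F'' s = 2 * Q' s - (1 - s) * Q'' s"
proof -
  have "((\<lambda>s. Q s - (1 - s) * Q' s) has_real_derivative (2 * Q' s - (1 - s) * Q'' s)) (at s)"
    using s by (auto intro!: derivative_eq_intros Q_deriv Q'_deriv)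
  moreover have "eventually (\<lambda>x. F' x = Q x - (1 - x) * Q' x) (nhds s)"
    using eventually_nhds_unit[OF s] by eventually_elim (rule F'_eq)
  ultimately have "(F' has_real_derivative (2 * Q' s - (1 - s) * Q'' s)) (at s)"
    by (subst DERIV_cong_ev[OF refl _ refl])
  with F'_deriv[OF s] show ?thesis by (rule DERIV_unique)
qed

lemma gf_nonnegs:
  assumes "0 \<le> s" "s < 1"
  shows "0 \<le> F s" "0 \<le> F' s" "0 \<le> F'' s" "0 \<le> Q s" "0 \<le> Q' s" "0 \<le> Q'' s"
  using assms unit_summables nonneg tail_nonneg by (auto intro!: gf_nonneg diffs_nonneg)

lemma F_le_1: "0 \<le> s \<Longrightarrow> s < 1 \<Longrightarrow> F s \<le> 1"
  using gf_nonnegs(4)[of s] by (simp add: F_eq)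

lemma F'_le: "0 \<le> s \<Longrightarrow> s < 1 \<Longrightarrow> F' s \<le> Q s"
  using gf_nonnegs(5)[of s] by (simp add: F'_eq)

lemma F''_le: "0 \<le> s \<Longrightarrow> s < 1 \<Longrightarrow> F'' s \<le> 2 * Q' s"
  using gf_nonnegs(6)[of s] by (simp add: F''_eq)

text \<open>Tails of any law tend to 0, so this holds without moments. Its consequences for
  \<open>G\<close> and \<open>G'\<close> are the a priori knowledge about \<open>X\<close>.\<close>

lemma Q_small: "((\<lambda>s. (1 - s) * Q s) \<longlongrightarrow> 0) (at_left 1)"
  by (rule abel_mean[OF tail_tendsto_0])

lemma Q'_small: "((\<lambda>s. (1 - s)\<^sup>2 * Q' s) \<longlongrightarrow> 0) (at_left 1)"
  using abel_mean_Suc[of "\<lambda>n. tail (Suc n)" 0] LIMSEQ_Suc[OF tail_tendsto_0]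
  by (simp add: diffs_def[abs_def])

lemma F_tendsto_1: "(F \<longlongrightarrow> 1) (at_left 1)"
proof -
  have "((\<lambda>s. 1 - (1 - s) * Q s) \<longlongrightarrow> 1 - 0) (at_left 1)" by (intro tendsto_intros Q_small)
  then have "((\<lambda>s. 1 - (1 - s) * Q s) \<longlongrightarrow> 1) (at_left 1)" by simp
  then show ?thesis
    by (rule Lim_transform_eventually) (use eventually_at_left_one in eventually_elim, auto simp: F_eq)
qed

lemma F'_small: "((\<lambda>s. (1 - s) * F' s) \<longlongrightarrow> 0) (at_left 1)"
  by (rule tendsto_sandwich[OF _ _ tendsto_const Q_small]; rule eventually_mono[OF eventually_at_left_one])
    (auto intro!: mult_nonneg_nonneg mult_left_mono gf_nonnegs F'_le)

lemma F''_small: "((\<lambda>s. (1 - s)\<^sup>2 * F'' s) \<longlongrightarrow> 0) (at_left 1)"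
proof (rule tendsto_sandwich[OF _ _ tendsto_const])
  show "((\<lambda>s. 2 * ((1 - s)\<^sup>2 * Q' s)) \<longlongrightarrow> 0) (at_left 1)"
    using tendsto_mult_left[OF Q'_small, of 2] by simp
  show "eventually (\<lambda>s. (1 - s)\<^sup>2 * F'' s \<le> 2 * ((1 - s)\<^sup>2 * Q' s)) (at_left 1)"
    using eventually_at_left_one
  proof eventually_elim
    case (elim s)
    then show ?case using mult_left_mono[OF F''_le[of s], of "(1 - s)\<^sup>2"] by simp
  qed
  show "eventually (\<lambda>s. 0 \<le> (1 - s)\<^sup>2 * F'' s) (at_left 1)"
    using eventually_at_left_one by eventually_elim (auto intro!: mult_nonneg_nonneg gf_nonnegs)
qed

section \<open>The logarithmic derivative and its derivative\<close>

definition G :: "real \<Rightarrow> real" where "G s = F' s / F s"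
definition G' :: "real \<Rightarrow> real" where "G' s = F'' s / F s - (F' s / F s)\<^sup>2"

text \<open>\<open>F 0 = p 0\<close> may vanish, which is why the logarithmic derivative is handled
  on the open interval only.\<close>

lemma F_pos: assumes "0 < s" "s < 1" shows "0 < F s"
proof -
  have "\<exists>n. p n > 0"
  proof (rule ccontr)
    assume "\<not> ?thesis"
    then have "p = (\<lambda>_. 0)" using nonneg by (intro ext) (auto simp: not_less intro: antisym)
    with sums_1 show False by (auto dest: sums_unique)
  qed
  then obtain n where n: "p n > 0" ..
  have "0 < p n * s ^ n" using n assms by simp
  also have "\<dots> \<le> F s" unfolding gf_def
    using sum_le_suminf[OF unit_summableD[OF unit_summable_p], of s "{n}"] assms nonneg by auto
  finally show ?thesis .
qed

lemma G_nonneg: "0 < s \<Longrightarrow> s < 1 \<Longrightarrow> 0 \<le> G s"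
  using F_pos[of s] gf_nonnegs[of s] by (simp add: G_def)

lemma G_deriv: "0 < s \<Longrightarrow> s < 1 \<Longrightarrow> (G has_real_derivative G' s) (at s)"
  unfolding G_def[abs_def] G'_def using F_pos[of s]
  by (auto intro!: derivative_eq_intros F_deriv F'_deriv simp: field_simps power2_eq_square)

lemma G_small: "((\<lambda>s. (1 - s) * G s) \<longlongrightarrow> 0) (at_left 1)"
  using tendsto_divide[OF F'_small F_tendsto_1] by (simp add: G_def)

lemma G'_small: "((\<lambda>s. (1 - s)\<^sup>2 * G' s) \<longlongrightarrow> 0) (at_left 1)"
  using tendsto_diff[OF tendsto_divide[OF F''_small F_tendsto_1] tendsto_power[OF G_small, of 2]]
  by (simp add: G_def G'_def right_diff_distrib power_mult_distrib power_divide)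

lemma Q_le_sum:
  assumes "tail sums b" "0 \<le> s" "s < 1"
  shows "Q s \<le> b"
proof -
  have "Q s \<le> (\<Sum>n. tail n)" unfolding gf_def
    using assms unit_summable_tail tail_nonneg
    by (intro suminf_le unit_summableD) (auto intro!: mult_left_le power_le_one simp: sums_iff)
  with assms(1) show ?thesis by (simp add: sums_iff)
qed

text \<open>Abel's theorem for nonnegative terms: \<open>Q\<close> lies below \<open>b\<close> and
  above each of its partial sums, which are continuous at 1.\<close>

lemma Q_tendsto_sum:
  assumes "tail sums b"
  shows "(Q \<longlongrightarrow> b) (at_left 1)"
proof (rule tendstoI)
  fix e :: real assume e: "e > 0"
  have "eventually (\<lambda>n. dist (\<Sum>k<n. tail k) b < e) sequentially"
    using assms e unfolding sums_def tendsto_iff by blast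
  then obtain n where n: "dist (\<Sum>k<n. tail k) b < e" by (auto simp: eventually_sequentially)
  have "((\<lambda>s. \<Sum>k<n. tail k * s ^ k) \<longlongrightarrow> (\<Sum>k<n. tail k * 1 ^ k)) (at_left 1)"
    by (intro tendsto_intros)
  then have "eventually (\<lambda>s. (\<Sum>k<n. tail k * s ^ k) > b - e) (at_left 1)"
    by (rule order_tendstoD) (use n in \<open>auto simp: dist_real_def\<close>)
  then show "eventually (\<lambda>s. dist (Q s) b < e) (at_left 1)"
    using eventually_at_left_one
  proof eventually_elim
    case (elim s)
    have "(\<Sum>k<n. tail k * s ^ k) \<le> Q s" unfolding gf_def
      using elim tail_nonneg by (intro sum_le_suminf unit_summableD unit_summable_tail) auto
    moreover have "Q s \<le> b" using elim assms by (intro Q_le_sum) auto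
    ultimately show ?case using elim by (simp add: dist_real_def)
  qed
qed

end

section \<open>Perturbed linear recursions\<close>

text \<open>Unrolling \<open>n\<close> times writes \<open>v s\<close> as a sum of source terms with
  weights at most \<open>\<rho> ^ k\<close>, plus a product of multipliers times \<open>v\<close> at
  the last iterate. That this remainder vanishes is a hypothesis because \<open>v\<close> may be
  unbounded near 1. Since \<open>s \<le> f s\<close>, the orbit never leaves the interval where the
  bounds hold.\<close>

lemma recursion_bound:
  fixes f v c \<beta> :: "real \<Rightarrow> real" and s0 :: real
  assumes f: "\<And>s. s0 < s \<Longrightarrow> s < 1 \<Longrightarrow> s \<le> f s \<and> f s < 1"
    and v: "\<And>s. s0 < s \<Longrightarrow> s < 1 \<Longrightarrow> v s = c s + \<beta> s * v (f s)"
    and c: "\<And>s. s0 < s \<Longrightarrow> s < 1 \<Longrightarrow> \<bar>c s\<bar> \<le> C"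
    and \<beta>: "\<And>s. s0 < s \<Longrightarrow> s < 1 \<Longrightarrow> 0 \<le> \<beta> s \<and> \<beta> s \<le> \<rho>" and \<rho>: "\<rho> < 1"
    and s: "s0 < s" "s < 1"
    and rem: "(\<lambda>n. (\<Prod>j<n. \<beta> ((f ^^ j) s)) * v ((f ^^ n) s)) \<longlonglongrightarrow> 0"
  shows "\<bar>v s\<bar> \<le> C / (1 - \<rho>)"
proof -
  have C: "0 \<le> C" and \<rho>0: "0 \<le> \<rho>" using c[OF s] \<beta>[OF s] by auto
  have it: "s0 < (f ^^ n) s \<and> (f ^^ n) s < 1" for n
    by (induction n) (use s f in \<open>auto intro: less_le_trans\<close>)
  define P where "P n = (\<Prod>j<n. \<beta> ((f ^^ j) s))" for n
  have P: "0 \<le> P n \<and> P n \<le> \<rho> ^ n" for n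
  proof (induction n)
    case (Suc n)
    have "P (Suc n) = P n * \<beta> ((f ^^ n) s)" by (simp add: P_def)
    then show ?case using Suc \<beta>[of "(f ^^ n) s"] it[of n] \<rho>0
        mult_mono[of "P n" "\<rho> ^ n" "\<beta> ((f ^^ n) s)" \<rho>] by (simp add: mult.commute)
  qed (simp add: P_def)
  \<comment> \<open>Each induction step moves one source term from the remainder into the geometric
    sum.\<close>
  have bound: "\<bar>v s\<bar> \<le> C * (\<Sum>k<n. \<rho> ^ k) + \<bar>P n * v ((f ^^ n) s)\<bar>" for n
  proof (induction n)
    case (Suc n)
    let ?u = "(f ^^ n) s"
    have "P n * v ?u = P n * c ?u + P (Suc n) * v (f ?u)"
      using v[of ?u] it[of n] by (simp add: P_def algebra_simps)
    moreover have "\<bar>P n * c ?u\<bar> \<le> C * \<rho> ^ n"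
      using mult_mono[of "P n" "\<rho> ^ n" "\<bar>c ?u\<bar>" C] c[of ?u] it[of n] P[of n] \<rho>0
      by (simp add: abs_mult mult.commute)
    ultimately have "\<bar>P n * v ?u\<bar> \<le> C * \<rho> ^ n + \<bar>P (Suc n) * v (f ?u)\<bar>" by linarith
    with Suc show ?case by (simp add: algebra_simps)
  qed (simp add: P_def)
  have "(\<Sum>k<n. \<rho> ^ k) \<le> 1 / (1 - \<rho>)" for n
    using \<rho>0 \<rho> sum_le_suminf[OF summable_geometric[of \<rho>], of "{..<n}"] by (simp add: suminf_geometric)
  then have sum_bound: "C * (\<Sum>k<n. \<rho> ^ k) \<le> C * (1 / (1 - \<rho>))" for n by (rule mult_left_mono[OF _ C])
  have "\<bar>v s\<bar> \<le> C / (1 - \<rho>) + \<bar>P n * v ((f ^^ n) s)\<bar>" for n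
    using bound[of n] sum_bound[of n] by simp
  moreover have "(\<lambda>n. C / (1 - \<rho>) + \<bar>P n * v ((f ^^ n) s)\<bar>) \<longlonglongrightarrow> C / (1 - \<rho>) + \<bar>0\<bar>"
    using rem unfolding P_def by (intro tendsto_intros)
  ultimately show ?thesis using LIMSEQ_le_const by fastforce
qed

lemma recursion_bounded:
  fixes f v c \<beta> :: "real \<Rightarrow> real"
  assumes f: "\<And>s. 0 < s \<Longrightarrow> s < 1 \<Longrightarrow> s \<le> f s \<and> f s < 1"
    and v: "\<And>s. 0 < s \<Longrightarrow> s < 1 \<Longrightarrow> v s = c s + \<beta> s * v (f s)"
    and c: "eventually (\<lambda>s. \<bar>c s\<bar> \<le> C) (at_left 1)"
    and \<beta>0: "\<And>s. 0 < s \<Longrightarrow> s < 1 \<Longrightarrow> 0 \<le> \<beta> s"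
    and \<beta>: "eventually (\<lambda>s. \<beta> s \<le> \<rho>) (at_left 1)" and \<rho>: "\<rho> < 1"
    and rem: "eventually (\<lambda>s. (\<lambda>n. (\<Prod>j<n. \<beta> ((f ^^ j) s)) * v ((f ^^ n) s)) \<longlonglongrightarrow> 0) (at_left 1)"
  shows "eventually (\<lambda>s. \<bar>v s\<bar> \<le> C / (1 - \<rho>)) (at_left 1)"
proof -
  have "eventually (\<lambda>s. \<bar>c s\<bar> \<le> C \<and> \<beta> s \<le> \<rho> \<and>
      (\<lambda>n. (\<Prod>j<n. \<beta> ((f ^^ j) s)) * v ((f ^^ n) s)) \<longlonglongrightarrow> 0 \<and> 0 < s \<and> s < 1) (at_left 1)"
    using c \<beta> rem eventually_at_left_one by eventually_elim auto
  then obtain s0 where s0: "s0 < 1" "\<And>s. s0 < s \<Longrightarrow> s < 1 \<Longrightarrow> \<bar>c s\<bar> \<le> C \<and> \<beta> s \<le> \<rho> \<and>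
      (\<lambda>n. (\<Prod>j<n. \<beta> ((f ^^ j) s)) * v ((f ^^ n) s)) \<longlonglongrightarrow> 0 \<and> 0 < s"
    by (subst (asm) eventually_at_left[of 0]) auto
  have "\<bar>v s\<bar> \<le> C / (1 - \<rho>)" if "s0 < s" "s < 1" for s
    by (rule recursion_bound[of s0 f v c \<beta> C \<rho>]) (use s0 f v \<beta>0 \<rho> that in blast)+
  then show ?thesis using s0(1) by (subst eventually_at_left[of 0]) auto
qed

text \<open>The limit solves \<open>d = c0 + b * d\<close>. Subtracting it leaves the same recursion
  with a source tending to 0, so the uniform bound becomes arbitrarily small.\<close>

lemma recursion_tendsto:
  fixes f v c \<beta> :: "real \<Rightarrow> real"
  assumes f: "\<And>s. 0 < s \<Longrightarrow> s < 1 \<Longrightarrow> s \<le> f s \<and> f s < 1"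
    and v: "\<And>s. 0 < s \<Longrightarrow> s < 1 \<Longrightarrow> v s = c s + \<beta> s * v (f s)"
    and c: "(c \<longlongrightarrow> c0) (at_left 1)"
    and \<beta>0: "\<And>s. 0 < s \<Longrightarrow> s < 1 \<Longrightarrow> 0 \<le> \<beta> s"
    and \<beta>: "(\<beta> \<longlongrightarrow> b) (at_left 1)" and b: "b < 1"
    and rem: "\<And>s. 0 < s \<Longrightarrow> s < 1 \<Longrightarrow> (\<lambda>n. (\<Prod>j<n. \<beta> ((f ^^ j) s)) * v ((f ^^ n) s)) \<longlonglongrightarrow> 0"
  shows "(v \<longlongrightarrow> c0 / (1 - b)) (at_left 1)"
proof (rule tendstoI)
  fix e :: real assume e: "e > 0"
  define d where "d = c0 / (1 - b)"
  obtain \<rho> where \<rho>: "b < \<rho>" "\<rho> < 1" using b dense by blast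
  define w where "w s = v s - d" for s
  define c' where "c' s = c s + \<beta> s * d - d" for s
  have "(c' \<longlongrightarrow> c0 + b * d - d) (at_left 1)" unfolding c'_def by (intro tendsto_intros c \<beta>)
  moreover have "c0 + b * d - d = 0" using b by (simp add: d_def field_simps)
  ultimately have c': "(c' \<longlongrightarrow> 0) (at_left 1)" by simp
  have evb: "eventually (\<lambda>s. \<beta> s \<le> \<rho>) (at_left 1)"
    using order_tendstoD(2)[OF \<beta> \<rho>(1)] by eventually_elim auto
  then have "eventually (\<lambda>s. \<beta> s \<le> \<rho> \<and> 0 < s \<and> s < 1) (at_left 1)"
    using eventually_at_left_one by eventually_elim auto
  then obtain s0 where s0: "s0 < 1" "\<And>s. s0 < s \<Longrightarrow> s < 1 \<Longrightarrow> \<beta> s \<le> \<rho> \<and> 0 < s"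
    by (subst (asm) eventually_at_left[of 0]) auto
  \<comment> \<open>The remainder of \<open>w\<close> is that of \<open>v\<close> minus
    \<open>d\<close> times the bare product, so the product has to vanish as well; it decays like
    \<open>\<rho> ^ n\<close>.\<close>
  have prod0: "(\<lambda>n. \<Prod>j<n. \<beta> ((f ^^ j) s)) \<longlonglongrightarrow> 0" if s: "s0 < s" "s < 1" for s
  proof (rule tendsto_sandwich[OF _ _ tendsto_const LIMSEQ_power_zero[of \<rho>]])
    have it: "s0 < (f ^^ n) s \<and> (f ^^ n) s < 1" for n
    proof (induction n)
      case (Suc n)
      then show ?case using f[of "(f ^^ n) s"] s0(2)[of "(f ^^ n) s"] by auto
    qed (use s in auto)
    show "eventually (\<lambda>n. (\<Prod>j<n. \<beta> ((f ^^ j) s)) \<le> \<rho> ^ n) sequentially"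
    proof (rule always_eventually, rule allI)
      fix n show "(\<Prod>j<n. \<beta> ((f ^^ j) s)) \<le> \<rho> ^ n"
        using prod_mono[of "{..<n}" "\<lambda>j. \<beta> ((f ^^ j) s)" "\<lambda>_. \<rho>"] it s0(2) \<beta>0 by auto
    qed
    show "eventually (\<lambda>n. 0 \<le> (\<Prod>j<n. \<beta> ((f ^^ j) s))) sequentially"
      using it s0(2) \<beta>0 by (intro always_eventually allI prod_nonneg) auto
    show "norm \<rho> < 1" using \<rho> s0(2)[OF that] \<beta>0[of s] s by auto
  qed
  \<comment> \<open>Chosen such that the resulting bound \<open>D / (1 - \<rho>)\<close> equals
    \<open>e / 2\<close>.\<close>
  define D where "D = e / 2 * (1 - \<rho>)"
  have D: "D > 0" using e \<rho> by (simp add: D_def)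
  have De: "D / (1 - \<rho>) = e / 2" unfolding D_def using \<rho> by (intro nonzero_mult_div_cancel_right) auto
  have "eventually (\<lambda>s. \<bar>w s\<bar> \<le> D / (1 - \<rho>)) (at_left 1)"
  proof (rule recursion_bounded[OF f _ _ \<beta>0 evb \<rho>(2)])
    fix s :: real assume "0 < s" "s < 1"
    then show "w s = c' s + \<beta> s * w (f s)" using v[of s] by (simp add: w_def c'_def algebra_simps)
  next
    show "eventually (\<lambda>s. \<bar>c' s\<bar> \<le> D) (at_left 1)"
      using tendstoD[OF c' D]
      by (auto elim!: eventually_mono simp: dist_real_def)
  next
    show "eventually (\<lambda>s. (\<lambda>n. (\<Prod>j<n. \<beta> ((f ^^ j) s)) * w ((f ^^ n) s)) \<longlonglongrightarrow> 0) (at_left 1)"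
    proof -
      have "(\<lambda>n. (\<Prod>j<n. \<beta> ((f ^^ j) s)) * w ((f ^^ n) s)) \<longlonglongrightarrow> 0" if s: "s0 < s" "s < 1" for s
        using tendsto_diff[OF rem[of s] tendsto_mult_left[OF prod0[OF s], of d]] s0(2)[of s] s
        by (simp add: w_def algebra_simps)
      then show ?thesis using s0(1) by (subst eventually_at_left[of 0]) auto
    qed
  qed auto
  then show "eventually (\<lambda>s. dist (v s) (c0 / (1 - b)) < e) (at_left 1)"
    unfolding dist_real_def
    using e by (auto elim!: eventually_mono simp: w_def d_def De)
qed

section \<open>From the second derivative of \<open>F\<close> to the first derivative of
  \<open>Q\<close>\<close>

context prob_seq
begin

text \<open>The identity for \<open>F''\<close> says that \<open>(1 - s)^2 * Q' s\<close> has
  derivative \<open>- (1 - s) * F'' s\<close>, so l'Hopital's rule applies to its quotient by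
  \<open>1 - s\<close>. The gain is that the coefficients of \<open>Q'\<close> contain the tails
  themselves rather than the point masses.\<close>

lemma Q'_tendsto:
  assumes "((\<lambda>s. (1 - s) * F'' s) \<longlongrightarrow> c) (at_left 1)"
  shows "((\<lambda>s. (1 - s) * Q' s) \<longlongrightarrow> c) (at_left 1)"
proof -
  have "((\<lambda>s. (1 - s)\<^sup>2 * Q' s / (1 - s)) \<longlongrightarrow> c) (at_left 1)"
  proof (rule lhopital_left[where g' = "\<lambda>_. -1" and f' = "\<lambda>s. - ((1 - s) * F'' s)"])
    show "((\<lambda>s::real. 1 - s) \<longlongrightarrow> 0) (at_left 1)" by real_asymp
    show "eventually (\<lambda>s::real. 1 - s \<noteq> 0) (at_left 1)"
      using eventually_at_left_one by eventually_elim auto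
    show "eventually (\<lambda>s. ((\<lambda>s. (1 - s)\<^sup>2 * Q' s) has_real_derivative - ((1 - s)
        * F'' s)) (at s)) (at_left 1)"
      using eventually_at_left_one
    proof eventually_elim
      case (elim s)
      then have "((\<lambda>s. (1 - s)\<^sup>2 * Q' s) has_real_derivative (1 - s)\<^sup>2 * Q'' s - 2 * (1 - s) * Q' s) (at s)"
        by (auto intro!: derivative_eq_intros Q'_deriv simp: algebra_simps)
      moreover have "(1 - s)\<^sup>2 * Q'' s - 2 * (1 - s) * Q' s = - ((1 - s) * F'' s)"
        using elim by (simp add: F''_eq power2_eq_square algebra_simps)
      ultimately show ?case by simp
    qed
    show "((\<lambda>s. - ((1 - s) * F'' s) / - 1) \<longlongrightarrow> c) (at_left 1)" using assms by simp
    show "eventually (\<lambda>s. ((\<lambda>s::real. 1 - s) has_real_derivative - 1) (at s)) (at_left 1)"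
      by (intro always_eventually allI) (auto intro!: derivative_eq_intros)
  qed (use Q'_small in auto)
  then show ?thesis
    by (rule Lim_transform_eventually)
      (use eventually_at_left_one in eventually_elim, auto simp: power2_eq_square)
qed

end

section \<open>Karamata's Tauberian theorem for monotone sequences\<close>

lemma one_minus_power_ratio: "((\<lambda>s::real. (1 - s) / (1 - s ^ Suc k)) \<longlongrightarrow> 1 / real (Suc k)) (at_left 1)"
proof -
  have "((\<lambda>s::real. 1 / (\<Sum>i\<le>k. s ^ i)) \<longlongrightarrow> 1 / (\<Sum>i\<le>k. 1 ^ i)) (at_left 1)"
    by (intro tendsto_intros) auto
  then have "((\<lambda>s::real. 1 / (\<Sum>i\<le>k. s ^ i)) \<longlongrightarrow> 1 / real (Suc k)) (at_left 1)" by simp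
  then show ?thesis
  proof (rule Lim_transform_eventually)
    show "eventually (\<lambda>s::real. 1 / (\<Sum>i\<le>k. s ^ i) = (1 - s) / (1 - s ^ Suc k)) (at_left 1)"
      using eventually_at_left_one
    proof eventually_elim
      case (elim s)
      then show ?case
        unfolding sum_gp_basic[symmetric] by (subst nonzero_divide_mult_cancel_left) auto
    qed
  qed
qed

lemma filterlim_power_at_left_1: "filterlim (\<lambda>s::real. s ^ Suc k) (at_left 1) (at_left 1)"
proof -
  have "((\<lambda>s::real. s ^ Suc k) \<longlongrightarrow> 1 ^ Suc k) (at_left 1)" by (intro tendsto_intros)
  moreover have "eventually (\<lambda>s::real. s ^ Suc k \<in> {..<1} \<and> s ^ Suc k \<noteq> 1) (at_left 1)"
    using eventually_at_left_one
  proof eventually_elim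
    case (elim s)
    then have "s ^ Suc k < 1" by (intro power_Suc_less_one) auto
    then show ?case by auto
  qed
  ultimately show ?thesis by (simp add: filterlim_at)
qed

text \<open>Weighting with \<open>(s ^ n) ^ k\<close> amounts to evaluating at
  \<open>s ^ Suc k\<close>; the factor \<open>1 / (k + 1)\<close> is the integral of
  \<open>x ^ k\<close> over the unit interval.\<close>

lemma karamata_monomial:
  assumes lim: "((\<lambda>s. (1 - s) * gf a s) \<longlongrightarrow> c) (at_left 1)"
  shows "((\<lambda>s. (1 - s) * gf (\<lambda>n. a n * (s ^ n) ^ k) s) \<longlongrightarrow> c / real (Suc k)) (at_left 1)"
proof -
  have "((\<lambda>s. (1 - s) / (1 - s ^ Suc k) * ((1 - s ^ Suc k) * gf a (s ^ Suc k))) \<longlongrightarrow> 1 / real (Suc k)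
      * c) (at_left 1)"
    by (rule tendsto_mult[OF one_minus_power_ratio filterlim_compose[OF lim filterlim_power_at_left_1]])
  then have "((\<lambda>s. (1 - s) / (1 - s ^ Suc k) * ((1 - s ^ Suc k) * gf a (s ^ Suc k)))
      \<longlongrightarrow> c / real (Suc k)) (at_left 1)"
    by simp
  then show ?thesis
  proof (rule Lim_transform_eventually)
    show "eventually (\<lambda>s. (1 - s) / (1 - s ^ Suc k) * ((1 - s ^ Suc k) * gf a (s ^ Suc k)) =
        (1 - s) * gf (\<lambda>n. a n * (s ^ n) ^ k) s) (at_left 1)"
      using eventually_at_left_one
    proof eventually_elim
      case (elim s)
      then have "s ^ Suc k < 1" by (intro power_Suc_less_one) auto
      moreover have "gf (\<lambda>n. a n * (s ^ n) ^ k) s = gf a (s ^ Suc k)"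
        unfolding gf_def by (simp add: power_mult_distrib mult_ac flip: power_mult)
      ultimately show ?case by simp
    qed
  qed
qed

lemma integral_power_unit: "integral {0..1} (\<lambda>x::real. x ^ k) = 1 / real (Suc k)"
proof -
  have "((\<lambda>x::real. x ^ k) has_integral 1 ^ Suc k / real (Suc k) - 0 ^ Suc k / real (Suc k)) {0..1}"
  proof (rule fundamental_theorem_of_calculus)
    fix x :: real
    have "((\<lambda>x. x ^ Suc k / real (Suc k)) has_real_derivative x ^ k) (at x within {0..1})"
      by (rule derivative_eq_intros refl | simp)+
    then show "((\<lambda>x. x ^ Suc k / real (Suc k)) has_vector_derivative x ^ k) (at x within {0..1})"
      by (rule has_real_derivative_iff_has_vector_derivative[THEN iffD1])
  qed auto
  then show ?thesis by (simp add: integral_unique)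
qed

lemma unit_summable_continuous_weight:
  fixes g :: "real \<Rightarrow> real"
  assumes a: "unit_summable a" "\<And>n. 0 \<le> a n" and g: "\<And>x. x \<in> {0..1} \<Longrightarrow> \<bar>g x\<bar> \<le> C"
    and s: "0 \<le> s" "s \<le> 1"
  shows "unit_summable (\<lambda>n. a n * g (s ^ n))"
proof (rule unit_summable_weighted[OF a BseqI'])
  fix n show "norm (g (s ^ n)) \<le> C" using s by (simp add: g power_le_one)
qed

lemma continuous_on_unit_bounded:
  fixes g :: "real \<Rightarrow> real"
  assumes "continuous_on {0..1} g"
  obtains C where "\<And>x. x \<in> {0..1} \<Longrightarrow> \<bar>g x\<bar> \<le> C"
proof -
  have "bounded (g ` {0..1})" by (intro compact_imp_bounded compact_continuous_image assms) auto
  then obtain C where "\<forall>y\<in>g ` {0..1}. norm y \<le> C" unfolding bounded_iff by blast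
  then show ?thesis by (intro that[of C]) auto
qed

lemma karamata_polynomial:
  assumes a: "unit_summable a" "\<And>n. 0 \<le> a n"
    and lim: "((\<lambda>s. (1 - s) * gf a s) \<longlongrightarrow> c) (at_left 1)"
  shows "((\<lambda>s. (1 - s) * gf (\<lambda>n. a n * (\<Sum>k\<le>m. d k * (s ^ n) ^ k)) s) \<longlongrightarrow>
    c * integral {0..1} (\<lambda>x. \<Sum>k\<le>m. d k * x ^ k)) (at_left 1)"
proof -
  have "((\<lambda>s. \<Sum>k\<le>m. d k * ((1 - s) * gf (\<lambda>n. a n * (s ^ n) ^ k) s)) \<longlongrightarrow> (\<Sum>k\<le>m. d k
      * (c / real (Suc k)))) (at_left 1)"
    by (intro tendsto_intros karamata_monomial lim)
  moreover have "(\<Sum>k\<le>m. d k * (c / real (Suc k))) = c * integral {0..1} (\<lambda>x. \<Sum>k\<le>m. d k * x ^ k)"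
  proof -
    have "integral {0..1} (\<lambda>x. \<Sum>k\<le>m. d k * x ^ k) = (\<Sum>k\<le>m. integral {0..1} (\<lambda>x. d k * x ^ k))"
      by (intro integral_sum integrable_continuous_real continuous_intros) auto
    also have "\<dots> = (\<Sum>k\<le>m. d k / real (Suc k))"
      by (simp add: integral_power_unit)
    finally show ?thesis by (simp add: sum_distrib_left mult_ac)
  qed
  moreover have "eventually (\<lambda>s. (\<Sum>k\<le>m. d k * ((1 - s) * gf (\<lambda>n. a n * (s ^ n) ^ k) s)) =
     (1 - s) * gf (\<lambda>n. a n * (\<Sum>k\<le>m. d k * (s ^ n) ^ k)) s) (at_left 1)"
    using eventually_at_left_one
  proof eventually_elim
    case (elim s)
    have us: "unit_summable (\<lambda>n. a n * (s ^ n) ^ k)" for k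
      by (rule unit_summable_continuous_weight[OF a, of "\<lambda>x. x ^ k" 1])
          (use elim in \<open>auto simp: power_le_one\<close>)
    have "gf (\<lambda>n. a n * (\<Sum>k\<le>m. d k * (s ^ n) ^ k)) s = (\<Sum>n. \<Sum>k\<le>m. d k * (a n * (s ^ n) ^ k * s ^ n))"
      unfolding gf_def by (simp add: sum_distrib_left sum_distrib_right mult_ac)
    also have "\<dots> = (\<Sum>k\<le>m. \<Sum>n. d k * (a n * (s ^ n) ^ k * s ^ n))"
      by (rule suminf_sum) (use elim us in \<open>auto intro!: summable_mult unit_summableD\<close>)
    also have "\<dots> = (\<Sum>k\<le>m. d k * gf (\<lambda>n. a n * (s ^ n) ^ k) s)"
      unfolding gf_def by (intro sum.cong refl suminf_mult unit_summableD us) (use elim in auto)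
    finally show ?case by (simp add: sum_distrib_left mult_ac)
  qed
  ultimately show ?thesis using Lim_transform_eventually by force
qed

text \<open>Uniform polynomial approximation: as \<open>a\<close> is nonnegative, replacing
  \<open>g\<close> by a polynomial within \<open>h\<close> changes the sum by at most
  \<open>h * gf a s\<close>, and \<open>(1 - s) * gf a s\<close> stays bounded.\<close>

lemma karamata_continuous:
  assumes a: "unit_summable a" "\<And>n. 0 \<le> a n"
    and lim: "((\<lambda>s. (1 - s) * gf a s) \<longlongrightarrow> c) (at_left 1)"
    and g: "continuous_on {0..1} g"
  shows "((\<lambda>s. (1 - s) * gf (\<lambda>n. a n * g (s ^ n)) s) \<longlongrightarrow> c * integral {0..1} g) (at_left 1)"
proof (rule tendstoI)
  fix e :: real assume e: "e > 0"
  \<comment> \<open>\<open>K\<close> dominates both \<open>\<bar>c\<bar>\<close> and, eventually,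
    \<open>(1 - s) * gf a s\<close>. The 4 in \<open>h\<close> leaves room for three errors of size
    \<open>e / 4\<close>: in the sum, in the integral and in the limit for the polynomial.\<close>
  define K where "K = \<bar>c\<bar> + 1"
  define h where "h = e / (4 * K)"
  have h: "h > 0" and K: "K > 0" using e by (auto simp: h_def K_def)
  have hK: "h * K = e / 4" using K by (simp add: h_def)
  obtain P where P: "real_polynomial_function P" "\<And>x. x \<in> {0..1} \<Longrightarrow> \<bar>g x - P x\<bar> < h"
    using Stone_Weierstrass_real_polynomial_function[OF _ g h] by auto
  then obtain d m where Pd: "P = (\<lambda>x. \<Sum>k\<le>m. d k * x ^ k)"
    by (auto simp: real_polynomial_function_iff_sum)
  have contP: "continuous_on {0..1} P" unfolding Pd by (intro continuous_intros)
  obtain Cg where Cg: "\<And>x. x \<in> {0..1} \<Longrightarrow> \<bar>g x\<bar> \<le> Cg"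
    using continuous_on_unit_bounded[OF g] by blast
  obtain CP where CP: "\<And>x. x \<in> {0..1} \<Longrightarrow> \<bar>P x\<bar> \<le> CP"
    using continuous_on_unit_bounded[OF contP] by blast
  have "norm (integral {0..1} (\<lambda>x. g x - P x)) \<le> integral {0..1} (\<lambda>_::real. h)"
  proof (rule Henstock_Kurzweil_Integration.integral_norm_bound_integral)
    show "norm (g x - P x) \<le> h" if "x \<in> {0..1}" for x using P(2)[OF that] by simp
  qed (intro integrable_continuous_real continuous_intros g contP)+
  then have int: "\<bar>integral {0..1} g - integral {0..1} P\<bar> \<le> h"
    using integral_diff[OF integrable_continuous_real[OF g] integrable_continuous_real[OF contP]] by simp
  have int': "\<bar>c * integral {0..1} g - c * integral {0..1} P\<bar> \<le> e / 4"
  proof -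
    have "\<bar>c * integral {0..1} g - c * integral {0..1} P\<bar> = \<bar>c\<bar> * \<bar>integral {0..1} g - integral {0..1} P\<bar>"
      by (simp add: abs_mult flip: right_diff_distrib)
    also have "\<dots> \<le> K * h" using int K by (intro mult_mono) (auto simp: K_def)
    finally show ?thesis using hK by (simp add: mult.commute)
  qed
  have "eventually (\<lambda>s. dist ((1 - s) * gf (\<lambda>n. a n * P (s ^ n)) s) (c * integral {0..1} P)
      < e / 4) (at_left 1)"
    unfolding Pd by (rule tendstoD[OF karamata_polynomial[OF a lim]]) (use e in auto)
  moreover have "eventually (\<lambda>s. (1 - s) * gf a s < K) (at_left 1)"
    by (rule order_tendstoD[OF lim]) (auto simp: K_def)
  ultimately show "eventually (\<lambda>s. dist ((1 - s) * gf (\<lambda>n. a n * g (s ^ n)) s) (c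
      * integral {0..1} g) < e) (at_left 1)"
    using eventually_at_left_one
  proof eventually_elim
    case (elim s)
    have sn: "s ^ n \<in> {0..1}" for n using elim by (auto simp: power_le_one)
    have usg: "unit_summable (\<lambda>n. a n * g (s ^ n))" and usP: "unit_summable (\<lambda>n. a n * P (s ^ n))"
      using unit_summable_continuous_weight[OF a Cg, where s
          = s] unit_summable_continuous_weight[OF a CP, where s = s] elim by auto
    have "\<bar>gf (\<lambda>n. a n * g (s ^ n)) s - gf (\<lambda>n. a n * P (s ^ n)) s\<bar> = \<bar>gf (\<lambda>n. a n
        * (g (s ^ n) - P (s ^ n))) s\<bar>"
      using gf_diff[OF usg usP, of s] elim by (simp add: algebra_simps)
    also have "\<dots> \<le> gf (\<lambda>n. h * a n) s"
    proof (rule gf_abs_le[OF unit_summable_mult[OF a(1)]])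
      fix n show "\<bar>a n * (g (s ^ n) - P (s ^ n))\<bar> \<le> h * a n"
        using mult_left_mono[OF less_imp_le[OF P(2)[OF sn[of n]]] a(2)[of n]] a(2)[of n]
        by (simp add: abs_mult mult.commute)
    qed (use elim in auto)
    also have "\<dots> = h * gf a s" using elim by (simp add: gf_mult[OF a(1)])
    finally have "(1 - s) * \<bar>gf (\<lambda>n. a n * g (s ^ n)) s - gf (\<lambda>n. a n * P (s ^ n)) s\<bar> \<le> (1 - s) * (h
        * gf a s)"
      using elim by (intro mult_left_mono) auto
    also have "\<dots> \<le> h * K" using elim h by (simp add: mult.left_commute)
    finally have "\<bar>(1 - s) * gf (\<lambda>n. a n * g (s ^ n)) s - (1 - s) * gf (\<lambda>n. a n * P (s ^ n)) s\<bar> \<le> e / 4"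
      using elim hK by (simp add: abs_mult flip: right_diff_distrib)
    with int' elim(1) e show ?case unfolding dist_real_def by linarith
  qed
qed

text \<open>Testing against a bump \<open>g\<close> supported on \<open>{x. exp (- v) \<le> x \<le> exp (- u)}\<close> localizes
  the Abelian sums at \<open>s = exp (- 1 / N)\<close> to the window \<open>u * N \<le> n \<le> v * N\<close>.\<close>

lemma karamata_window:
  assumes a: "unit_summable a" "\<And>n. 0 \<le> a n"
    and lim: "((\<lambda>s. (1 - s) * gf a s) \<longlongrightarrow> c) (at_left 1)"
    and uv: "0 \<le> u" "u < v"
  obtains w :: "nat \<Rightarrow> nat \<Rightarrow> real"
  where "\<And>N n. 0 \<le> w N n" "\<And>N n. 0 < N \<Longrightarrow> w N n \<noteq> 0 \<Longrightarrow> u * real N \<le> real n \<and> real n \<le> v * real N"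
    "eventually (\<lambda>N. summable (w N) \<and> suminf (w N) > 0 \<and> summable (\<lambda>n. a n * w N n)) sequentially"
    "(\<lambda>N. (\<Sum>n. a n * w N n) / suminf (w N)) \<longlonglongrightarrow> c"
proof -
  \<comment> \<open>The quadratic is positive exactly between its two roots, so its positive part is
    a continuous bump and continuous test functions suffice.\<close>
  define g where "g x = max 0 ((x - exp (- v)) * (exp (- u) - x))" for x :: real
  have g0: "0 \<le> g x" for x by (simp add: g_def)
  have gc: "continuous_on {0..1} g" unfolding g_def by (intro continuous_intros)
  have gne: "g x = 0" if "x < exp (- v) \<or> exp (- u) < x" for x
  proof -
    have "exp (- v) < exp (- u)" using uv by simp
    then have "(x - exp (- v)) * (exp (- u) - x) \<le> 0" using that unfolding mult_le_0_iff by linarith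
    then show ?thesis by (simp add: g_def)
  qed
  \<comment> \<open>The midpoint of the roots lies in the unit interval, hence the integral of
    \<open>g\<close> is positive and may be divided by.\<close>
  define x0 where "x0 = (exp (- v) + exp (- u)) / 2"
  have "g x0 > 0" using uv by (auto simp: g_def x0_def less_max_iff_disj intro!: mult_pos_pos)
  moreover have "exp (- v) + exp (- u) \<le> 1 + 1" using uv by (intro add_mono) auto
  then have "x0 \<in> {0..1}" by (simp add: x0_def add_nonneg_nonneg)
  ultimately have "integral {0..1} g \<noteq> 0" using integral_eq_0_iff[OF gc] g0 by force
  moreover have "integral {0..1} g \<ge> 0"
    using g0 by (intro integral_nonneg integrable_continuous_real gc) auto
  ultimately have I: "integral {0..1} g > 0" by simp
  obtain Cg where Cg: "\<And>x. x \<in> {0..1} \<Longrightarrow> \<bar>g x\<bar> \<le> Cg"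
    using continuous_on_unit_bounded[OF gc] by blast
  define s where "s N = exp (- 1 / real N)" for N :: nat
  define w where "w N n = g (s N ^ n) * s N ^ n" for N n
  have s_lim: "filterlim s (at_left 1) sequentially" unfolding s_def by real_asymp
  have sn: "s N ^ n = exp (- (real n / real N))" for n N
    by (simp add: s_def flip: exp_of_nat_mult)
  have one: "((\<lambda>s. (1 - s) * gf (\<lambda>_. 1) s) \<longlongrightarrow> 1) (at_left 1)" by (rule abel_mean) simp
  have l1: "((\<lambda>N. (1 - s N) * gf (\<lambda>n. a n * g (s N ^ n)) (s N)) \<longlongrightarrow> c * integral {0..1} g) sequentially"
    by (rule filterlim_compose[OF karamata_continuous[OF a lim gc] s_lim])
  \<comment> \<open>The constant sequence 1 supplies the total weight; in the quotient of the two
    limits \<open>1 - s N\<close> and the integral of \<open>g\<close> cancel.\<close>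
  have l2: "((\<lambda>N. (1 - s N) * gf (\<lambda>n. 1 * g (s N ^ n)) (s N)) \<longlongrightarrow> 1 * integral {0..1} g) sequentially"
    by (rule filterlim_compose[OF karamata_continuous[OF unit_summable_one _ one gc] s_lim]) simp
  have ga: "gf (\<lambda>n. a n * g (s N ^ n)) (s N) = (\<Sum>n. a n * w N n)"
    and g1: "gf (\<lambda>n. 1 * g (s N ^ n)) (s N) = suminf (w N)" for N
    by (simp_all add: gf_def w_def[abs_def] mult_ac)
  have ev: "eventually (\<lambda>N. 0 < s N \<and> s N < 1) sequentially"
    using eventually_compose_filterlim[OF eventually_at_left_one s_lim] .
  show ?thesis
  proof
    show "0 \<le> w N n" for N n using g0 by (simp add: w_def s_def)
    show "u * real N \<le> real n \<and> real n \<le> v * real N" if "0 < N" "w N n \<noteq> 0" for N n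
    proof -
      have "\<not> (s N ^ n < exp (- v) \<or> exp (- u) < s N ^ n)"
        using that(2) gne[of "s N ^ n"] unfolding w_def by auto
      then show ?thesis using that(1) by (simp add: sn not_less field_simps)
    qed
    show "eventually (\<lambda>N. summable (w N) \<and> suminf (w N) > 0 \<and> summable (\<lambda>n. a n * w N n)) sequentially"
      using order_tendstoD(1)[OF l2[unfolded g1, simplified] I] ev
    proof eventually_elim
      case (elim N)
      have "unit_summable (\<lambda>n. a n * g (s N ^ n))" "unit_summable (\<lambda>n. 1 * g (s N ^ n))"
        using elim unit_summable_continuous_weight[OF a Cg, where s
            = "s N"] unit_summable_continuous_weight[OF unit_summable_one _ Cg, where s = "s N"] by auto
      from this[THEN unit_summableD, of "s N"] elim show ?case
        by (auto simp: w_def[abs_def] mult_ac zero_less_mult_iff)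
    qed
    have "(\<lambda>N. ((1 - s N) * gf (\<lambda>n. a n * g (s N ^ n)) (s N)) / ((1 - s N) * gf (\<lambda>n. 1
        * g (s N ^ n)) (s N)))
       \<longlonglongrightarrow> c * integral {0..1} g / (1 * integral {0..1} g)"
      by (rule tendsto_divide[OF l1 l2]) (use I in simp)
    then have "(\<lambda>N. ((1 - s N) * (\<Sum>n. a n * w N n)) / ((1 - s N) * suminf (w N))) \<longlonglongrightarrow> c"
      using I by (simp only: ga g1) simp
    then show "(\<lambda>N. (\<Sum>n. a n * w N n) / suminf (w N)) \<longlonglongrightarrow> c"
      by (rule Lim_transform_eventually) (use ev in eventually_elim, auto)
  qed
qed

text \<open>Monotonicity is the Tauberian condition. On a window just to the right of
  \<open>N\<close> the coefficients \<open>(n + 1) * q (n + 1)\<close> exceed \<open>N * q N\<close>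
  at most by a factor close to 1, so the windowed mean bounds \<open>N * q N\<close> from below; a
  window just to the left gives the bound from above.\<close>

lemma monotone_tauberian:
  assumes q: "decseq q" "\<And>n. 0 \<le> q n"
    and us: "unit_summable q"
    and lim: "((\<lambda>s. (1 - s) * gf (diffs q) s) \<longlongrightarrow> c) (at_left 1)"
  shows "(\<lambda>n. real n * q n) \<longlonglongrightarrow> c"
proof -
  note d = unit_summable_diffs[OF us]
  have d0: "0 \<le> diffs q n" for n using q by (simp add: diffs_def)
  have c0: "0 \<le> c"
    by (rule tendsto_lowerbound[OF lim])
      (use eventually_at_left_one in eventually_elim, auto intro!: mult_nonneg_nonneg gf_nonneg d d0)
  have lower: "eventually (\<lambda>N. l < real N * q N) sequentially" if l: "l < c" for l
  proof (cases "l < 0")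
    case True
    then show ?thesis by (intro always_eventually allI less_le_trans[OF True]) (simp add: q)
  next
    case False
    \<comment> \<open>\<open>l * \<delta>\<close> is then at most half of the gap
      \<open>c - l\<close>, so \<open>l * (1 + \<delta>)\<close> stays below
      \<open>c\<close>.\<close>
    define \<delta> where "\<delta> = (c - l) / (2 * c)"
    have cp: "c > 0" using l False by auto
    have \<delta>: "\<delta> > 0" using cp l by (simp add: \<delta>_def)
    have "l * \<delta> \<le> c * \<delta>" using \<delta> l by (intro mult_right_mono) auto
    also have "c * \<delta> = (c - l) / 2" using cp by (simp add: \<delta>_def)
    finally have \<delta>l: "l * (1 + \<delta>) < c" using l unfolding distrib_left by simp
    obtain w where w: "\<And>N n. 0 \<le> w N n"
      "\<And>N n. 0 < N \<Longrightarrow> w N n \<noteq> 0 \<Longrightarrow> 1 * real N \<le> real n \<and> real n \<le> (1 + \<delta>) * real N"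
      and wev: "eventually (\<lambda>N. summable (w N) \<and> suminf (w N) > 0 \<and> summable (\<lambda>n. diffs q n
          * w N n)) sequentially"
      and wlim: "(\<lambda>N. (\<Sum>n. diffs q n * w N n) / suminf (w N)) \<longlonglongrightarrow> c"
      using karamata_window[OF d d0 lim, of 1 "1 + \<delta>"] \<delta> by auto
    have "eventually (\<lambda>N. (\<Sum>n. diffs q n * w N n) / suminf (w N) > (l * (1 + \<delta>) + c) / 2) sequentially"
      by (rule order_tendstoD[OF wlim]) (use \<delta>l in auto)
    moreover have "eventually (\<lambda>N. (l * (1 + \<delta>) + c) / 2 * (real N / ((1 + \<delta>) * real N
        + 1)) > l) sequentially"
    proof (rule order_tendstoD)
      show "(\<lambda>N. (l * (1 + \<delta>) + c) / 2 * (real N / ((1 + \<delta>) * real N + 1))) \<longlonglongrightarrow> (l * (1 + \<delta>) + c) / 2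
          * inverse (1 + \<delta>)"
        using \<delta> by (intro tendsto_mult tendsto_const) real_asymp
      show "l < (l * (1 + \<delta>) + c) / 2 * inverse (1 + \<delta>)" using \<delta> \<delta>l by (simp add: field_simps)
    qed
    ultimately show ?thesis using wev eventually_gt_at_top[of 0]
    proof eventually_elim
      case (elim N)
      let ?W = "suminf (w N)"
      \<comment> \<open>The added 1 absorbs the index shift in
        \<open>diffs q n = (n + 1) * q (n + 1)\<close>.\<close>
      define k where "k = (1 + \<delta>) * real N + 1"
      have k: "k > 0" using \<delta> by (simp add: k_def add_nonneg_pos)
      have "(\<Sum>n. diffs q n * w N n) \<le> (\<Sum>n. (k * q N) * w N n)"
      proof (rule suminf_le)
        show "summable (\<lambda>n. k * q N * w N n)" using elim by (intro summable_mult) auto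
        fix n show "diffs q n * w N n \<le> k * q N * w N n"
        proof (cases "w N n = 0")
          case False
          then have n: "real N \<le> real n" "real n \<le> (1 + \<delta>) * real N" using w(2)[of N n] elim by auto
          have "diffs q n = real (Suc n) * q (Suc n)" by (simp add: diffs_def)
          also have "\<dots> \<le> k * q N" using n q k
            by (intro mult_mono decseqD[OF q(1)]) (auto simp: k_def)
          finally show ?thesis using w(1) by (intro mult_right_mono)
        qed simp
      qed (use elim in auto)
      also have "\<dots> = k * q N * ?W" using elim by (intro suminf_mult) auto
      finally have "(\<Sum>n. diffs q n * w N n) / ?W \<le> k * q N" using elim by (simp add: divide_le_eq)
      with elim have "(l * (1 + \<delta>) + c) / 2 < k * q N" by linarith
      then have "(l * (1 + \<delta>) + c) / 2 * (real N / k) \<le> k * q N * (real N / k)"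
        using k by (intro mult_right_mono) auto
      also have "\<dots> = real N * q N" using k by simp
      finally show ?case using elim by (simp add: k_def)
    qed
  qed
  have upper: "eventually (\<lambda>N. real N * q N < l) sequentially" if l: "c < l" for l
  proof -
    \<comment> \<open>The mirror choice: \<open>l * \<delta>\<close> is half of the gap, so
      \<open>l * (1 - \<delta>)\<close> stays above \<open>c\<close>.\<close>
    define \<delta> where "\<delta> = (l - c) / (2 * l)"
    have l0: "l > 0" using c0 l by simp
    have \<delta>: "0 < \<delta>" "\<delta> < 1" using l l0 c0 by (auto simp: \<delta>_def field_simps)
    have "l * \<delta> = (l - c) / 2" using l0 by (simp add: \<delta>_def)
    then have \<delta>l: "c < l * (1 - \<delta>)" using l unfolding right_diff_distrib by simp
    obtain w where w: "\<And>N n. 0 \<le> w N n"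
      "\<And>N n. 0 < N \<Longrightarrow> w N n \<noteq> 0 \<Longrightarrow> (1 - \<delta>) * real N \<le> real n \<and> real n \<le> 1 * real N"
      and wev: "eventually (\<lambda>N. summable (w N) \<and> suminf (w N) > 0 \<and> summable (\<lambda>n. diffs q n
          * w N n)) sequentially"
      and wlim: "(\<lambda>N. (\<Sum>n. diffs q n * w N n) / suminf (w N)) \<longlonglongrightarrow> c"
      using karamata_window[OF d d0 lim, of "1 - \<delta>" 1] \<delta> by auto
    define m where "m = (l * (1 - \<delta>) + c) / 2"
    have m: "c < m" "m < l * (1 - \<delta>)" using \<delta>l by (auto simp: m_def)
    have "eventually (\<lambda>N. (\<Sum>n. diffs q n * w N n) / suminf (w N) < m) sequentially"
      by (rule order_tendstoD(2)[OF wlim m(1)])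
    moreover have "eventually (\<lambda>N. m * (real (Suc N) / ((1 - \<delta>) * real N)) < l) sequentially"
    proof (rule order_tendstoD)
      show "(\<lambda>N. m * (real (Suc N) / ((1 - \<delta>) * real N))) \<longlonglongrightarrow> m * inverse (1 - \<delta>)"
        using \<delta> by (intro tendsto_mult tendsto_const) real_asymp
      show "m * inverse (1 - \<delta>) < l" using \<delta> m by (simp add: field_simps)
    qed
    \<comment> \<open>Stated at \<open>Suc N\<close> because the coefficients with
      \<open>n \<le> N\<close> involve \<open>q (n + 1)\<close>, none of which is below
      \<open>q (Suc N)\<close>.\<close>
    ultimately have "eventually (\<lambda>N. real (Suc N) * q (Suc N) < l) sequentially"
      using wev eventually_gt_at_top[of 0]
    proof eventually_elim
      case (elim N)
      let ?W = "suminf (w N)"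
      define k where "k = (1 - \<delta>) * real N"
      have k: "k > 0" using \<delta> elim by (simp add: k_def)
      have "(\<Sum>n. (k * q (Suc N)) * w N n) \<le> (\<Sum>n. diffs q n * w N n)"
      proof (rule suminf_le)
        show "summable (\<lambda>n. k * q (Suc N) * w N n)" using elim by (intro summable_mult) auto
        fix n show "k * q (Suc N) * w N n \<le> diffs q n * w N n"
        proof (cases "w N n = 0")
          case False
          then have n: "k \<le> real n" "n \<le> N" using w(2)[of N n] elim by (auto simp: k_def)
          have "k * q (Suc N) \<le> real (Suc n) * q (Suc n)" using n q k
            by (intro mult_mono decseqD[OF q(1)]) auto
          then show ?thesis using w(1) by (intro mult_right_mono) (auto simp: diffs_def)
        qed simp
      qed (use elim in auto)
      moreover have "(\<Sum>n. (k * q (Suc N)) * w N n) = k * q (Suc N) * ?W" using elim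
          by (intro suminf_mult) auto
      ultimately have "k * q (Suc N) \<le> (\<Sum>n. diffs q n * w N n) / ?W" using elim by (simp add: le_divide_eq)
      with elim have "k * q (Suc N) < m" by linarith
      then have "k * q (Suc N) * (real (Suc N) / k) \<le> m * (real (Suc N) / k)"
        using k by (intro mult_right_mono) auto
      moreover have "k * q (Suc N) * (real (Suc N) / k) = real (Suc N) * q (Suc N)" using k by simp
      ultimately show ?case using elim by (simp add: k_def)
    qed
    then show ?thesis by (subst eventually_sequentially_Suc[symmetric])
  qed
  show ?thesis using lower upper by (intro order_tendstoI)
qed

section \<open>The logarithmic scale, and laws with tails of order \<open>1 / n\<close>\<close>

definition ell :: "real \<Rightarrow> real" where "ell s = - ln (1 - s)"

lemma ell_pos: "0 < s \<Longrightarrow> s < 1 \<Longrightarrow> 0 < ell s"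
  by (simp add: ell_def)

lemma filterlim_ell: "filterlim ell at_top (at_left 1)"
  unfolding ell_def[abs_def] by real_asymp

lemma gf_harmonic:
  assumes "0 < s" "s < 1"
  shows "gf (\<lambda>n. 1 / real (Suc n)) s = ell s / s"
proof -
  have "ln (1 - s) = (\<Sum>n. (-1) ^ n * (1 / real (n + 1)) * (1 - s - 1) ^ Suc n)"
    by (rule ln_series) (use assms in auto)
  also have "\<dots> = (\<Sum>n. (- s) * (1 / real (Suc n) * s ^ n))"
  proof (rule suminf_cong)
    fix n
    have "(- 1) ^ n * (1 - s - 1) ^ Suc n = (- 1) ^ n * (- s) ^ n * (- s)" by simp
    also have "\<dots> = ((- 1) * (- s)) ^ n * (- s)" by (simp only: power_mult_distrib)
    also have "\<dots> = s ^ n * (- s)" by simp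
    finally have *: "(- 1) ^ n * (1 - s - 1) ^ Suc n = s ^ n * (- s)" .
    have "(- 1) ^ n * (1 / real (n + 1)) * (1 - s - 1) ^ Suc n = (1 / real (Suc n)) * ((- 1) ^ n
        * (1 - s - 1) ^ Suc n)"
      by (simp only: mult_ac Suc_eq_plus1)
    then show "(- 1) ^ n * (1 / real (n + 1)) * (1 - s - 1) ^ Suc n = - s * (1 / real (Suc n) * s ^ n)"
      unfolding * by (simp only: mult_ac)
  qed
  also have "\<dots> = (- s) * gf (\<lambda>n. 1 / real (Suc n)) s"
  proof -
    have "unit_summable (\<lambda>n. 1 / real (Suc n))" by (rule unit_summable_bounded[of _ 1]) simp
    from unit_summableD[OF this, of s] show ?thesis using assms unfolding gf_def by (intro suminf_mult) auto
  qed
  finally show ?thesis using assms by (simp add: ell_def field_simps)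
qed

lemma ell_sq_small: "((\<lambda>s. (1 - s) * (ell s)\<^sup>2) \<longlongrightarrow> 0) (at_left 1)"
  unfolding ell_def by real_asymp

context prob_seq
begin

text \<open>A bound \<open>tail n \<le> C / (n + 1)\<close> compares \<open>Q\<close> with the
  logarithm series. The final constant \<open>4 * C\<close> collects one factor 2 from
  \<open>s > 1 / 2\<close> and another from \<open>F s > 1 / 2\<close>.\<close>

lemma G_O_ell:
  assumes "(\<lambda>n. real n * tail n) \<longlonglongrightarrow> 1"
  obtains C where "0 < C" "eventually (\<lambda>s. G s \<le> C * ell s) (at_left 1)"
proof -
  have "(\<lambda>n. real n * tail n + tail n) \<longlonglongrightarrow> 1 + 0" by (intro tendsto_intros assms tail_tendsto_0)
  then have "Bseq (\<lambda>n. real n * tail n + tail n)" by (simp add: convergentI Cauchy_Bseq convergent_Cauchy)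
  then obtain C where C: "C > 0" "\<And>n. norm (real n * tail n + tail n) \<le> C" unfolding Bseq_def by auto
  have tl: "tail n \<le> C * (1 / real (Suc n))" for n
    using C(2)[of n] by (simp add: field_simps abs_le_iff)
  have us: "unit_summable (\<lambda>n. 1 / real (Suc n))" by (rule unit_summable_bounded[of _ 1]) simp
  have "eventually (\<lambda>s. F s > 1 / 2) (at_left 1)" by (rule order_tendstoD[OF F_tendsto_1]) simp
  moreover have "eventually (\<lambda>s::real. s > 1 / 2) (at_left 1)"
    by (rule order_tendstoD[OF tendsto_ident_at]) simp
  ultimately have "eventually (\<lambda>s. G s \<le> (4 * C) * ell s) (at_left 1)"
    using eventually_at_left_one
  proof eventually_elim
    case (elim s)
    have "F' s \<le> Q s" using elim by (intro F'_le) auto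
    also have "\<dots> \<le> gf (\<lambda>n. C * (1 / real (Suc n))) s"
      by (rule gf_mono[OF unit_summable_tail unit_summable_mult[OF us] tl]) (use elim in auto)
    also have "\<dots> = C * (ell s / s)" using elim gf_harmonic[of s] gf_mult[OF us, of s C] by simp
    also have "\<dots> \<le> C * (2 * ell s)"
      using elim C(1) ell_pos[of s] by (intro mult_left_mono) (auto simp: field_simps)
    finally have "F' s \<le> 2 * C * ell s" by simp
    also have "\<dots> \<le> (4 * C * ell s) * F s"
      using elim(1) mult_left_mono[of "1/2" "F s" "4 * C * ell s"] C(1) ell_pos[of s] elim by simp
    finally show ?case using elim(1) by (simp add: G_def divide_le_eq)
  qed
  then show ?thesis using C(1) by (intro that[of "4 * C"]) auto
qed

text \<open>\<open>(G s)^2\<close> is the difference between \<open>F'' / F\<close> and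
  \<open>G'\<close>; under a logarithmic bound it is negligible on the scale
  \<open>1 / (1 - s)\<close>.\<close>

lemma G_square_small:
  assumes "eventually (\<lambda>s. G s \<le> C * ell s) (at_left 1)"
  shows "((\<lambda>s. (1 - s) * (G s)\<^sup>2) \<longlongrightarrow> 0) (at_left 1)"
proof (rule tendsto_sandwich[OF _ _ tendsto_const])
  show "((\<lambda>s. C\<^sup>2 * ((1 - s) * (ell s)\<^sup>2)) \<longlongrightarrow> 0) (at_left 1)"
    using tendsto_mult_left[OF ell_sq_small, of "C\<^sup>2"] by simp
  show "eventually (\<lambda>s. 0 \<le> (1 - s) * (G s)\<^sup>2) (at_left 1)"
    using eventually_at_left_one by eventually_elim auto
  show "eventually (\<lambda>s. (1 - s) * (G s)\<^sup>2 \<le> C\<^sup>2 * ((1 - s) * (ell s)\<^sup>2)) (at_left 1)"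
    using assms eventually_at_left_one
  proof eventually_elim
    case (elim s)
    then have "(G s)\<^sup>2 \<le> (C * ell s)\<^sup>2" using G_nonneg[of s] by (intro power_mono) auto
    then show ?case using elim by (simp add: power_mult_distrib mult.left_commute)
  qed
qed

text \<open>In \<open>F'' = 2 * Q' - (1 - s) * Q''\<close> both Abelian means, suitably scaled, tend
  to 1, so the limit arises as \<open>2 - 1\<close>.\<close>

lemma G'_limit:
  assumes lim: "(\<lambda>n. real n * tail n) \<longlonglongrightarrow> 1"
  shows "((\<lambda>s. (1 - s) * G' s) \<longlongrightarrow> 1) (at_left 1)"
proof -
  have 1: "((\<lambda>s. (1 - s) * Q' s) \<longlongrightarrow> 1) (at_left 1)"
    by (rule abel_mean) (use LIMSEQ_Suc[OF lim] in \<open>simp add: diffs_def[abs_def]\<close>)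
  have "((\<lambda>s. (1 - s)\<^sup>2 * gf (\<lambda>n. real (Suc n) * (real (Suc (Suc n)) * tail (Suc (Suc n)))) s)
      \<longlongrightarrow> 1) (at_left 1)"
    by (rule abel_mean_Suc) (rule LIMSEQ_Suc[OF LIMSEQ_Suc[OF lim]])
  then have 2: "((\<lambda>s. (1 - s)\<^sup>2 * Q'' s) \<longlongrightarrow> 1) (at_left 1)"
    by (simp add: diffs_def[abs_def] mult_ac)
  have "((\<lambda>s. 2 * ((1 - s) * Q' s) - (1 - s)\<^sup>2 * Q'' s) \<longlongrightarrow> 2 * 1 - 1) (at_left 1)"
    by (intro tendsto_intros 1 2)
  then have "((\<lambda>s. 2 * ((1 - s) * Q' s) - (1 - s)\<^sup>2 * Q'' s) \<longlongrightarrow> 1) (at_left 1)" by simp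
  then have F'': "((\<lambda>s. (1 - s) * F'' s) \<longlongrightarrow> 1) (at_left 1)"
    by (rule Lim_transform_eventually)
      (use eventually_at_left_one in eventually_elim, auto simp: F''_eq algebra_simps power2_eq_square)
  obtain C where C: "0 < C" "eventually (\<lambda>s. G s \<le> C * ell s) (at_left 1)" by (rule G_O_ell[OF lim])
  have G2: "((\<lambda>s. (1 - s) * (G s)\<^sup>2) \<longlongrightarrow> 0) (at_left 1)"
    by (rule G_square_small[OF C(2)])
  have "((\<lambda>s. (1 - s) * F'' s / F s - (1 - s) * (G s)\<^sup>2) \<longlongrightarrow> 1 / 1 - 0) (at_left 1)"
    by (intro tendsto_intros F'' G2 F_tendsto_1) auto
  then show ?thesis by (simp add: G'_def G_def algebra_simps diff_divide_distrib)
qed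

end

text \<open>This is \<open>ln z \<le> z - 1\<close> at \<open>z = y / K\<close>: a large
  \<open>K\<close> makes the linear term small at the price of a constant.\<close>

lemma ln_le_divide_plus:
  fixes K y :: real
  assumes "0 < K" "0 < y"
  shows "ln y \<le> y / K + ln K"
  using ln_le_minus_one[of "y / K"] assms by (simp add: ln_div)

text \<open>With \<open>y = 1 / ((n + 2) * (1 - s))\<close> the inequality above gives
  \<open>ell s \<le> ln (n + 2) + y / K + ln K\<close>; the middle term is absorbed by the finite mean.\<close>

lemma (in prob_seq) Q'_ell_small:
  assumes sm: "tail sums b"
    and log: "(\<lambda>n. real (Suc n) * tail (Suc n) * ln (real (n + 2))) \<longlonglongrightarrow> 0"
  shows "((\<lambda>s. (1 - s) * ell s * Q' s) \<longlongrightarrow> 0) (at_left 1)"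
proof (rule tendstoI)
  fix e :: real assume e: "e > 0"
  define d where "d = diffs tail"
  have dt: "d n = real (Suc n) * tail (Suc n)" for n by (simp add: d_def diffs_def)
  have d0: "0 \<le> d n" for n by (simp add: dt tail_nonneg)
  have b0: "0 \<le> b" using sums_le[OF _ sums_zero sm] tail_nonneg by auto
  \<comment> \<open>Makes \<open>b / K\<close> smaller than \<open>e / 2\<close>; this is the part
    of the bound that does not vanish in the limit.\<close>
  define K where "K = 1 + 4 * b / e"
  have K1: "K \<ge> 1" using e b0 by (simp add: K_def)
  have "e / 2 * K = e / 2 + 2 * b" using e by (simp add: K_def field_simps)
  then have "b < e / 2 * K" using e b0 by linarith
  with K1 have K: "K \<ge> 1" "b / K < e / 2" by (simp_all add: divide_less_eq)
  have log': "(\<lambda>n. d n * ln (real (n + 2))) \<longlonglongrightarrow> 0" using log by (simp add: dt)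
  \<comment> \<open>\<open>ln (n + 2)\<close> is at least \<open>ln 2\<close>, so the decay of the
    product passes to \<open>d\<close> itself.\<close>
  have d_lim: "d \<longlonglongrightarrow> 0"
  proof (rule tendsto_sandwich[OF _ _ tendsto_const])
    show "(\<lambda>n. d n * ln (real (n + 2)) / ln 2) \<longlonglongrightarrow> 0"
        using tendsto_divide[OF log' tendsto_const[of "ln 2"]] by simp
    show "eventually (\<lambda>n. d n \<le> d n * ln (real (n + 2)) / ln 2) sequentially"
    proof (rule always_eventually, rule allI)
      fix n have "ln 2 \<le> ln (real (n + 2))" by simp
      then show "d n \<le> d n * ln (real (n + 2)) / ln 2"
        using mult_left_mono[OF _ d0[of n], of "ln 2" "ln (real (n + 2))"] by (simp add: le_divide_eq)
    qed
  qed (use d0 in simp)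
  have usd: "unit_summable d" using unit_summables by (simp add: d_def)
  have usl: "unit_summable (\<lambda>n. d n * ln (real (n + 2)))"
    by (rule unit_summable_convergent[OF log'])
  have usq: "unit_summable (\<lambda>n. tail (Suc n))"
    by (rule unit_summable_bounded[of _ 1]) (simp add: tail_nonneg tail_le_1)
  have main: "(1 - s) * ell s * Q' s \<le> (1 - s) * gf (\<lambda>n. d n * ln (real (n + 2))) s + b / K + ln K
      * ((1 - s) * gf d s)"
    if s: "0 < s" "s < 1" for s
  proof -
    have "ell s * gf d s = gf (\<lambda>n. ell s * d n) s" using gf_mult[OF usd] s by simp
    also have "\<dots> \<le> gf (\<lambda>n. d n * ln (real (n + 2)) + (1 / (K * (1 - s)) * tail (Suc n) + ln K * d n)) s"
    proof (rule gf_mono)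
      fix n
      \<comment> \<open>Locally \<open>y\<close> is \<open>n + 2\<close>; the logarithmic inequality
        is applied at \<open>1 / (y * (1 - s))\<close>.\<close>
      define y where "y = real (n + 2)"
      have y: "y > 0" "y \<ge> real (Suc n)" by (auto simp: y_def)
      have "ell s = ln (1 / (y * (1 - s))) + ln y"
        using s y by (simp add: ell_def ln_div ln_mult)
      also have "\<dots> \<le> 1 / (y * (1 - s)) / K + ln K + ln y"
        using ln_le_divide_plus[of K "1 / (y * (1 - s))"] s K y by simp
      finally have "ell s * d n \<le> (1 / (y * (1 - s)) / K + ln K + ln y) * d n"
        by (rule mult_right_mono[OF _ d0])
      \<comment> \<open>\<open>d n / y\<close> is at most a tail, and the tails sum to the mean, so
        after multiplication by \<open>1 - s\<close> this term contributes at most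
        \<open>b / K\<close>.\<close>
      moreover have "1 / (y * (1 - s)) / K * d n \<le> 1 / (K * (1 - s)) * tail (Suc n)"
      proof -
        have "d n \<le> tail (Suc n) * y"
          using mult_right_mono[OF y(2) tail_nonneg[of "Suc n"]] by (simp add: dt mult.commute)
        then have "d n / y \<le> tail (Suc n)" using y(1) by (simp add: divide_le_eq)
        then have "1 / (K * (1 - s)) * (d n / y) \<le> 1 / (K * (1 - s)) * tail (Suc n)"
          using s K by (intro mult_left_mono) auto
        then show ?thesis by (simp add: mult_ac)
      qed
      ultimately show "ell s * d n \<le> d n * ln (real (n + 2)) + (1 / (K * (1 - s)) * tail (Suc n)
          + ln K * d n)"
        unfolding y_def[symmetric] distrib_right by (simp add: mult_ac)
    qed (use s in \<open>simp_all only: unit_summable_mult[OF usd] unit_summable_add[OF usl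
          unit_summable_add[OF unit_summable_mult[OF usq] unit_summable_mult[OF usd]]]\<close>)
    also have "\<dots> = gf (\<lambda>n. d n * ln (real (n + 2))) s + (1 / (K * (1 - s)) * gf (\<lambda>n. tail (Suc n)) s
        + ln K * gf d s)"
      using s gf_add[OF usl unit_summable_add[OF unit_summable_mult[OF usq] unit_summable_mult[OF
          usd]], of s "1 / (K * (1 - s))" "ln K"]
        gf_add[OF unit_summable_mult[OF usq] unit_summable_mult[OF usd], of s "1 / (K * (1 - s))" "ln K"]
        gf_mult[OF usq, of s "1 / (K * (1 - s))"] gf_mult[OF usd, of s "ln K"] by simp
    finally have 1: "ell s * gf d s \<le> \<dots>" .
    have "gf (\<lambda>n. tail (Suc n)) s \<le> Q s"
      using s decseq_SucD[OF decseq_tail] by (intro gf_mono usq unit_summable_tail) auto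
    then have "gf (\<lambda>n. tail (Suc n)) s \<le> b" using Q_le_sum[OF sm, of s] s by linarith
    then have "1 / K * gf (\<lambda>n. tail (Suc n)) s \<le> b / K" using K by (simp add: divide_right_mono)
    moreover have "(1 - s) * (ell s * gf d s) \<le> (1 - s) * (gf (\<lambda>n. d n * ln (real (n + 2))) s
        + (1 / (K * (1 - s)) * gf (\<lambda>n. tail (Suc n)) s + ln K * gf d s))"
      using 1 s by (intro mult_left_mono) auto
    moreover have "(1 - s) * (1 / (K * (1 - s)) * gf (\<lambda>n. tail (Suc n)) s) = 1 / K
        * gf (\<lambda>n. tail (Suc n)) s"
      using s K by simp
    ultimately show ?thesis unfolding d_def[symmetric] distrib_left by (simp add: mult_ac)
  qed
  have "((\<lambda>s. (1 - s) * gf (\<lambda>n. d n * ln (real (n + 2))) s + b / K + ln K * ((1 - s) * gf d s)) \<longlongrightarrow> 0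
      + b / K + ln K * 0) (at_left 1)"
    by (intro tendsto_intros abel_mean d_lim log')
  then have "eventually (\<lambda>s. (1 - s) * gf (\<lambda>n. d n * ln (real (n + 2))) s + b / K + ln K * ((1 - s)
      * gf d s) < e) (at_left 1)"
    by (rule order_tendstoD) (use K(2) e in linarith)
  then show "eventually (\<lambda>s. dist ((1 - s) * ell s * Q' s) 0 < e) (at_left 1)"
    using eventually_at_left_one
  proof eventually_elim
    case (elim s)
    have "0 \<le> (1 - s) * ell s * Q' s" using elim ell_pos[of s] gf_nonnegs[of s] by simp
    with main[of s] elim show ?case by (simp add: dist_real_def)
  qed
qed

section \<open>The fixed-point equation for generating functions\<close>

text \<open>The analytic core, detached from random variables: \<open>X\<close> enters through the
  functional equation and as a sequence of masses with sum 1. \<open>log_B\<close> is the form in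
  which the decay of \<open>L x * ln x\<close> is used.\<close>

locale stationary_pgf = A: prob_seq pA + B: prob_seq pB + X: prob_seq pX
  for pA pB pX :: "nat \<Rightarrow> real" +
  fixes b :: real
  assumes fixpoint: "0 < s \<Longrightarrow> s < 1 \<Longrightarrow> gf pX s = gf pA s * gf pX (gf pB s)"
    and tail_A: "(\<lambda>n. real n * A.tail n) \<longlonglongrightarrow> 1"
    and mean_B: "B.tail sums b" and b: "0 < b" "b < 1"
    and log_B: "(\<lambda>n. real (Suc n) * B.tail (Suc n) * ln (real (n + 2))) \<longlonglongrightarrow> 0"
begin

abbreviation "f \<equiv> B.F"

text \<open>If the tail at 0 vanished, so would all tails and the mean. Positivity keeps
  \<open>f s\<close> strictly below 1 and permits division by \<open>B.Q s\<close>.\<close>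

lemma BQ_pos: assumes "0 < s" "s < 1" shows "0 < B.Q s"
proof -
  have "B.tail 0 > 0"
  proof (rule ccontr)
    assume "\<not> ?thesis"
    then have "B.tail n = 0" for n using decseqD[OF B.decseq_tail, of 0 n] B.tail_nonneg[of n] by simp
    then have "B.tail = (\<lambda>_. 0)" by auto
    with mean_B b show False by (auto dest: sums_unique)
  qed
  moreover have "B.tail 0 * s ^ 0 \<le> B.Q s" unfolding gf_def
    using sum_le_suminf[OF unit_summableD[OF B.unit_summable_tail], of s "{0}"] assms B.tail_nonneg by auto
  ultimately show ?thesis by simp
qed

lemma BQ_le: "0 < s \<Longrightarrow> s < 1 \<Longrightarrow> B.Q s \<le> b"
  by (rule B.Q_le_sum[OF mean_B]) auto

lemma f_eq: "0 < s \<Longrightarrow> s < 1 \<Longrightarrow> 1 - f s = (1 - s) * B.Q s"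
  by (simp add: B.F_eq)

lemma f_bounds: assumes "0 < s" "s < 1" shows "s \<le> f s" "f s < 1"
proof -
  have "1 - f s \<le> (1 - s) * 1"
    unfolding f_eq[OF assms] using BQ_le[of s] b assms by (intro mult_left_mono) auto
  then show "s \<le> f s" by simp
  have "0 < (1 - s) * B.Q s" using BQ_pos[of s] assms by simp
  then show "f s < 1" using f_eq[of s] assms by simp
qed

text \<open>\<open>B.Q\<close> at the current point is the exact factor by which one step shrinks
  the distance to 1, and it never exceeds \<open>b\<close>.\<close>

lemma iterate_bounds:
  assumes "0 < s" "s < 1"
  shows "s \<le> (f ^^ n) s" "(f ^^ n) s < 1" "1 - (f ^^ n) s \<le> b ^ n * (1 - s)"
proof (induction n)
  case (Suc n)
  {
    case 1 show ?case using Suc f_bounds(1)[of "(f ^^ n) s"] assms by simp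
  next
    case 2 show ?case using Suc f_bounds(2)[of "(f ^^ n) s"] assms by simp
  next
    case 3
    have "1 - (f ^^ Suc n) s = (1 - (f ^^ n) s) * B.Q ((f ^^ n) s)"
      using Suc assms by (simp add: f_eq)
    also have "\<dots> \<le> (b ^ n * (1 - s)) * b"
      using Suc assms BQ_le[of "(f ^^ n) s"] BQ_pos[of "(f ^^ n) s"] b by (intro mult_mono) auto
    finally show ?case by (simp add: mult_ac)
  }
qed (use assms in auto)

lemma iterate_at_left:
  assumes s: "0 < s" "s < 1"
  shows "filterlim (\<lambda>n. (f ^^ n) s) (at_left 1) sequentially"
proof -
  have "(\<lambda>n. b ^ n * (1 - s)) \<longlonglongrightarrow> 0"
    using b by (intro tendsto_mult_left_zero LIMSEQ_power_zero) auto
  then have "(\<lambda>n. 1 - (f ^^ n) s) \<longlonglongrightarrow> 0"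
    by (rule tendsto_sandwich[OF _ _ tendsto_const, rotated 2])
      (use iterate_bounds[OF s] in \<open>auto intro!: always_eventually less_imp_le\<close>)
  from tendsto_diff[OF tendsto_const[of 1] this] have "(\<lambda>n. (f ^^ n) s) \<longlonglongrightarrow> 1" by simp
  then show ?thesis using iterate_bounds(2)[OF s] by (auto simp: filterlim_at intro!:
      always_eventually less_imp_neq)
qed

lemma f_at_left: "filterlim f (at_left 1) (at_left 1)"
  using B.F_tendsto_1 eventually_mono[OF eventually_at_left_one, of "\<lambda>s. f s < 1 \<and> f s \<noteq> 1"] f_bounds(2)
  by (fastforce simp: filterlim_at)

text \<open>\<open>B.F' u \<le> B.Q u = (1 - f u) / (1 - u)\<close>, and these quotients telescope
  along the orbit. The numerator left over is the distance to 1, whose powers occur in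
  \<open>X.G_small\<close> and \<open>X.G'_small\<close>.\<close>

lemma prod_F'_le:
  assumes s: "0 < s" "s < 1"
  shows "(\<Prod>j<n. B.F' ((f ^^ j) s)) \<le> (1 - (f ^^ n) s) / (1 - s)"
proof (induction n)
  case (Suc n)
  let ?u = "(f ^^ n) s"
  note u = iterate_bounds[OF s, of n]
  have "(\<Prod>j<Suc n. B.F' ((f ^^ j) s)) = (\<Prod>j<n. B.F' ((f ^^ j) s)) * B.F' ?u" by simp
  also have "\<dots> \<le> (1 - ?u) / (1 - s) * B.Q ?u"
    using Suc u s by (intro mult_mono B.F'_le B.gf_nonnegs) auto
  also have "\<dots> = (1 - (f ^^ Suc n) s) / (1 - s)" using u s by (simp add: f_eq)
  finally show ?case .
qed (use s in simp)

lemma prod_F'_nonneg: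
  assumes s: "0 < s" "s < 1"
  shows "0 \<le> (\<Prod>j<n. B.F' ((f ^^ j) s))"
proof (rule prod_nonneg)
  fix j show "0 \<le> B.F' ((f ^^ j) s)" using iterate_bounds[OF s, of j] s by (intro B.gf_nonnegs) auto
qed

section \<open>Recursions for the logarithmic derivative of \<open>X\<close>\<close>

lemma F'_rec:
  assumes s: "0 < s" "s < 1"
  shows "X.F' s = A.F' s * X.F (f s) + A.F s * (X.F' (f s) * B.F' s)"
proof -
  have "((\<lambda>s. A.F s * X.F (f s)) has_real_derivative A.F' s * X.F (f s) + A.F s * (X.F' (f s)
      * B.F' s)) (at s)"
    using s f_bounds[OF s]
    by (auto intro!: derivative_eq_intros A.F_deriv B.F_deriv DERIV_chain2[of X.F] X.F_deriv)
  moreover have "eventually (\<lambda>x. X.F x = A.F x * X.F (f x)) (nhds s)"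
    using eventually_nhds_in_open[of "{0<..<1}" s] s by (auto elim!: eventually_mono simp: fixpoint)
  ultimately have "(X.F has_real_derivative A.F' s * X.F (f s) + A.F s * (X.F' (f s) * B.F' s)) (at s)"
    by (subst DERIV_cong_ev[OF refl _ refl])
  with X.F_deriv[of s] s show ?thesis by (auto intro: DERIV_unique)
qed

text \<open>Dividing the differentiated equation by the equation itself removes \<open>A.F\<close>
  from the multiplier, which becomes \<open>B.F'\<close> alone.\<close>

lemma G_rec:
  assumes s: "0 < s" "s < 1"
  shows "X.G s = A.G s + B.F' s * X.G (f s)"
proof -
  have "A.F s > 0" "X.F (f s) > 0" using A.F_pos X.F_pos f_bounds[OF s] s by auto
  then show ?thesis unfolding X.G_def A.G_def F'_rec[OF s] fixpoint[OF s] by (simp add: field_simps)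
qed

lemma G'_rec:
  assumes s: "0 < s" "s < 1"
  shows "X.G' s = A.G' s + B.F'' s * X.G (f s) + (B.F' s)\<^sup>2 * X.G' (f s)"
proof -
  have d: "((\<lambda>x. X.G (f x)) has_real_derivative X.G' (f s) * B.F' s) (at s)"
    using s f_bounds[OF s] by (intro DERIV_chain2[of X.G] X.G_deriv B.F_deriv) auto
  have "((\<lambda>s. A.G s + B.F' s * X.G (f s)) has_real_derivative
      A.G' s + B.F'' s * X.G (f s) + (B.F' s)\<^sup>2 * X.G' (f s)) (at s)"
    using s by (auto intro!: derivative_eq_intros A.G_deriv B.F'_deriv d simp: power2_eq_square)
  moreover have "eventually (\<lambda>x. X.G x = A.G x + B.F' x * X.G (f x)) (nhds s)"
    using eventually_nhds_in_open[of "{0<..<1}" s] s by (auto elim!: eventually_mono simp: G_rec)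
  ultimately have "(X.G has_real_derivative A.G' s + B.F'' s * X.G (f s) + (B.F' s)\<^sup>2 * X.G' (f s)) (at s)"
    by (subst DERIV_cong_ev[OF refl _ refl])
  with X.G_deriv[OF s] show ?thesis by (auto intro: DERIV_unique)
qed

text \<open>In \<open>F' = Q - (1 - s) * Q'\<close> the first term tends to \<open>b\<close>, and
  the second is an Abelian mean of the null sequence \<open>(n + 1) * tail (n + 1)\<close>.\<close>

lemma BF'_tendsto: "(B.F' \<longlongrightarrow> b) (at_left 1)"
proof -
  have "(\<lambda>n. real (Suc n) * B.tail (Suc n)) \<longlonglongrightarrow> 0"
  proof (rule tendsto_sandwich[OF _ _ tendsto_const])
    show "(\<lambda>n. real (Suc n) * B.tail (Suc n) * ln (real (n + 2)) / ln 2) \<longlonglongrightarrow> 0"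
      using tendsto_divide[OF log_B tendsto_const[of "ln 2"]] by simp
    show "eventually (\<lambda>n. real (Suc n) * B.tail (Suc n) \<le> real (Suc n) * B.tail (Suc n)
        * ln (real (n + 2)) / ln 2) sequentially"
    proof (rule always_eventually, rule allI)
      fix n
      have "real (Suc n) * B.tail (Suc n) * ln 2 \<le> real (Suc n) * B.tail (Suc n) * ln (real (n + 2))"
        by (intro mult_left_mono) (auto simp: B.tail_nonneg)
      then show "real (Suc n) * B.tail (Suc n) \<le> real (Suc n) * B.tail (Suc n) * ln (real (n + 2)) / ln 2"
        by (simp add: le_divide_eq)
    qed
  qed (auto simp: B.tail_nonneg)
  then have "((\<lambda>s. (1 - s) * B.Q' s) \<longlongrightarrow> 0) (at_left 1)"
    by (intro abel_mean) (simp add: diffs_def[abs_def])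
  from tendsto_diff[OF B.Q_tendsto_sum[OF mean_B] this]
  have "((\<lambda>s. B.Q s - (1 - s) * B.Q' s) \<longlongrightarrow> b) (at_left 1)" by simp
  then show ?thesis
    by (rule Lim_transform_eventually) (use eventually_at_left_one in eventually_elim, auto simp: B.F'_eq)
qed

text \<open>\<open>1 - f s = (1 - s) * B.Q s\<close> gives
  \<open>ell (f s) = ell s - ln (B.Q s)\<close>, a bounded perturbation since \<open>B.Q\<close>
  tends to \<open>b > 0\<close>.\<close>

lemma ell_f_ratio: "((\<lambda>s. ell (f s) / ell s) \<longlongrightarrow> 1) (at_left 1)"
proof -
  have "((\<lambda>s. 1 - ln (B.Q s) / ell s) \<longlongrightarrow> 1 - 0) (at_left 1)"
    by (intro tendsto_diff tendsto_const tendsto_divide_0[OF tendsto_ln[OF B.Q_tendsto_sum[OF mean_B]]]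
      filterlim_at_top_imp_at_infinity filterlim_ell) (use b in auto)
  then have "((\<lambda>s. 1 - ln (B.Q s) / ell s) \<longlongrightarrow> 1) (at_left 1)" by simp
  then show ?thesis
  proof (rule Lim_transform_eventually)
    show "eventually (\<lambda>s. 1 - ln (B.Q s) / ell s = ell (f s) / ell s) (at_left 1)"
      using eventually_at_left_one
    proof eventually_elim
      case (elim s)
      have "ell (f s) = ell s - ln (B.Q s)" using elim BQ_pos[of s] by (simp add: ell_def f_eq ln_mult)
      then show ?case using ell_pos[of s] elim by (simp add: diff_divide_distrib)
    qed
  qed
qed

text \<open>After division by \<open>ell\<close> the recursion for \<open>X.G\<close> has a bounded
  source, and its multiplier still tends to \<open>b\<close>.\<close>

lemma XG_O_ell:
  obtains K where "0 < K" "eventually (\<lambda>s. X.G s \<le> K * ell s) (at_left 1)"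
proof -
  obtain C where C: "0 < C" "eventually (\<lambda>s. A.G s \<le> C * ell s) (at_left 1)" by (rule A.G_O_ell[OF tail_A])
  obtain \<rho> where \<rho>: "b < \<rho>" "\<rho> < 1" using b dense by blast
  define v where "v s = X.G s / ell s" for s
  define \<beta> where "\<beta> s = B.F' s * (ell (f s) / ell s)" for s
  have "eventually (\<lambda>s. \<bar>v s\<bar> \<le> C / (1 - \<rho>)) (at_left 1)"
  proof (rule recursion_bounded[where f = f and v = v and c = "\<lambda>s. A.G s / ell s" and \<beta> = \<beta> and \<rho> = \<rho>])
    show "s \<le> f s \<and> f s < 1" if "0 < s" "s < 1" for s using f_bounds that by auto
    show "v s = A.G s / ell s + \<beta> s * v (f s)" if s: "0 < s" "s < 1" for s
    proof -
      have "ell s > 0" "ell (f s) > 0" using ell_pos f_bounds[OF s] s by auto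
      then show ?thesis unfolding v_def \<beta>_def G_rec[OF s] by (simp add: add_divide_distrib)
    qed
    show "eventually (\<lambda>s. \<bar>A.G s / ell s\<bar> \<le> C) (at_left 1)"
      using C(2) eventually_at_left_one
    proof eventually_elim
      case (elim s)
      then show ?case using ell_pos[of s] A.G_nonneg[of s] by (simp add: divide_le_eq)
    qed
    show "0 \<le> \<beta> s" if s: "0 < s" "s < 1" for s
      unfolding \<beta>_def using ell_pos[of s] ell_pos[of "f s"] f_bounds[OF s] s
          by (intro mult_nonneg_nonneg B.gf_nonnegs divide_nonneg_nonneg) auto
    have "(\<beta> \<longlongrightarrow> b * 1) (at_left 1)" unfolding \<beta>_def by (intro tendsto_mult BF'_tendsto ell_f_ratio)
    then show "eventually (\<lambda>s. \<beta> s \<le> \<rho>) (at_left 1)"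
      using order_tendstoD(2)[of \<beta> b "at_left 1" \<rho>] \<rho> by (auto elim!: eventually_mono)
    show "eventually (\<lambda>s. (\<lambda>n. (\<Prod>j<n. \<beta> ((f ^^ j) s)) * v ((f ^^ n) s)) \<longlonglongrightarrow> 0) (at_left 1)"
      using eventually_at_left_one
    proof eventually_elim
      case (elim s)
      then have s: "0 < s" "s < 1" by auto
      have u: "0 < (f ^^ n) s" "(f ^^ n) s < 1" for n using iterate_bounds[OF s, of n] s by auto
      note eu = ell_pos[OF u]
      \<comment> \<open>The quotients of \<open>ell\<close> telescope and then cancel against the
        denominator of \<open>v\<close>, leaving the product of the derivatives.\<close>
      have pr: "(\<Prod>j<n. \<beta> ((f ^^ j) s)) = (\<Prod>j<n. B.F' ((f ^^ j) s)) * (ell ((f ^^ n) s) / ell s)" for n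
      proof (induction n)
        case (Suc n)
        then show ?case using eu[of n] by (simp add: \<beta>_def)
      qed (use eu[of 0] in simp)
      have eq: "(\<Prod>j<n. \<beta> ((f ^^ j) s)) * v ((f ^^ n) s) = (\<Prod>j<n. B.F' ((f ^^ j) s))
          * X.G ((f ^^ n) s) / ell s" for n
        unfolding pr v_def using eu[of n] by simp
      \<comment> \<open>Bounding the product by \<open>prod_F'_le\<close> leaves the distance to 1
        times \<open>X.G\<close> along the orbit, which is the a priori null sequence.\<close>
      have lim: "(\<lambda>n. (1 - (f ^^ n) s) * X.G ((f ^^ n) s) / ((1 - s) * ell s)) \<longlonglongrightarrow> 0"
        using tendsto_divide[OF filterlim_compose[OF X.G_small iterate_at_left[OF s]]
            tendsto_const[of "(1 - s) * ell s"]] s eu[of 0]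
        by simp
      show ?case unfolding eq
      proof (rule tendsto_sandwich[OF _ _ tendsto_const lim]; intro always_eventually allI)
        fix n
        show "0 \<le> (\<Prod>j<n. B.F' ((f ^^ j) s)) * X.G ((f ^^ n) s) / ell s"
          using prod_F'_nonneg[OF s, of n] X.G_nonneg[OF u, of n] eu[of 0] by simp
        show "(\<Prod>j<n. B.F' ((f ^^ j) s)) * X.G ((f ^^ n) s) / ell s \<le> (1 - (f ^^ n) s)
            * X.G ((f ^^ n) s) / ((1 - s) * ell s)"
          using divide_right_mono[OF mult_right_mono[OF prod_F'_le[OF s, of n] X.G_nonneg[OF u, of
              n]], of "ell s"] eu[of 0]
          by simp
      qed
    qed
  qed (use \<rho> in auto)
  then have "eventually (\<lambda>s. X.G s \<le> C / (1 - \<rho>) * ell s) (at_left 1)"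
    using eventually_at_left_one
  proof eventually_elim
    case (elim s)
    then have "v s \<le> C / (1 - \<rho>)" by linarith
    then have "X.G s / ell s \<le> C / (1 - \<rho>)" unfolding v_def .
    then show ?case using ell_pos[of s] elim by (simp add: divide_le_eq)
  qed
  then show ?thesis using C \<rho> by (intro that[of "C / (1 - \<rho>)"]) auto
qed

text \<open>The logarithm in \<open>X.G\<close> meets the unbounded \<open>B.F''\<close>. Replacing
  \<open>ell (f s)\<close> by \<open>ell s\<close> up to a factor tending to 1 reduces the product
  to \<open>(1 - s) * ell s * B.Q' s\<close>.\<close>

lemma cross_term_small: "((\<lambda>s. (1 - s) * B.F'' s * X.G (f s)) \<longlongrightarrow> 0) (at_left 1)"
proof -
  obtain K where K: "0 < K" "eventually (\<lambda>s. X.G s \<le> K * ell s) (at_left 1)" by (rule XG_O_ell)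
  have ev: "eventually (\<lambda>s. X.G (f s) \<le> K * ell (f s)) (at_left 1)"
    by (rule eventually_compose_filterlim[OF K(2) f_at_left])
  have lim: "((\<lambda>s. 2 * K * (ell (f s) / ell s) * ((1 - s) * ell s * B.Q' s)) \<longlongrightarrow> 2 * K * 1 * 0) (at_left 1)"
    by (intro tendsto_intros ell_f_ratio B.Q'_ell_small[OF mean_B log_B])
  show ?thesis
  proof (rule tendsto_sandwich[OF _ _ tendsto_const])
    show "((\<lambda>s. 2 * K * (ell (f s) / ell s) * ((1 - s) * ell s * B.Q' s)) \<longlongrightarrow> 0) (at_left 1)"
      using lim by simp
    show "eventually (\<lambda>s. 0 \<le> (1 - s) * B.F'' s * X.G (f s)) (at_left 1)"
      using eventually_at_left_one
    proof eventually_elim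
      case (elim s)
      then show ?case using f_bounds[of s] X.G_nonneg[of "f s"] B.gf_nonnegs[of s] by simp
    qed
    show "eventually (\<lambda>s. (1 - s) * B.F'' s * X.G (f s) \<le> 2 * K * (ell (f s) / ell s) * ((1 - s)
        * ell s * B.Q' s)) (at_left 1)"
      using ev eventually_at_left_one
    proof eventually_elim
      case (elim s)
      have "B.F'' s * X.G (f s) \<le> (2 * B.Q' s) * (K * ell (f s))"
        using elim f_bounds[of s] X.G_nonneg[of "f s"] B.gf_nonnegs[of s] B.F''_le[of s]
            by (intro mult_mono) auto
      then have "(1 - s) * (B.F'' s * X.G (f s)) \<le> (1 - s) * ((2 * B.Q' s) * (K * ell (f s)))"
        using elim by (intro mult_left_mono) auto
      also have "\<dots> = 2 * K * (ell (f s) / ell s) * ((1 - s) * ell s * B.Q' s)"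
        using ell_pos[of s] elim by simp
      finally show ?case by simp
    qed
  qed
qed

text \<open>Writing \<open>1 - s\<close> as \<open>(1 - f s) / B.Q s\<close> in the recursion for
  \<open>X.G'\<close> produces the multiplier \<open>(B.F' s)^2 / B.Q s\<close>.\<close>

lemma XG'_limit: "((\<lambda>s. (1 - s) * X.G' s) \<longlongrightarrow> 1 / (1 - b)) (at_left 1)"
proof (rule recursion_tendsto[where f = f and \<beta> = "\<lambda>s. (B.F' s)\<^sup>2 / B.Q s"
    and c = "\<lambda>s. (1 - s) * A.G' s + (1 - s) * B.F'' s * X.G (f s)"])
  show "s \<le> f s \<and> f s < 1" if "0 < s" "s < 1" for s using f_bounds that by auto
  show "(1 - s) * X.G' s = (1 - s) * A.G' s + (1 - s) * B.F'' s * X.G (f s) +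
      (B.F' s)\<^sup>2 / B.Q s * ((1 - f s) * X.G' (f s))" if s: "0 < s" "s < 1" for s
    unfolding G'_rec[OF s] f_eq[OF s] using BQ_pos[OF s] by (simp add: algebra_simps)
  have "((\<lambda>s. (1 - s) * A.G' s + (1 - s) * B.F'' s * X.G (f s)) \<longlongrightarrow> 1 + 0) (at_left 1)"
    by (intro tendsto_add A.G'_limit[OF tail_A] cross_term_small)
  then show "((\<lambda>s. (1 - s) * A.G' s + (1 - s) * B.F'' s * X.G (f s)) \<longlongrightarrow> 1) (at_left 1)" by simp
  show "0 \<le> (B.F' s)\<^sup>2 / B.Q s" if s: "0 < s" "s < 1" for s using BQ_pos[OF s] by simp
  have "((\<lambda>s. (B.F' s)\<^sup>2 / B.Q s) \<longlongrightarrow> b\<^sup>2 / b) (at_left 1)"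
    using b by (intro tendsto_intros BF'_tendsto B.Q_tendsto_sum mean_B) auto
  then show "((\<lambda>s. (B.F' s)\<^sup>2 / B.Q s) \<longlongrightarrow> b) (at_left 1)" using b by (simp add: power2_eq_square)
  fix s :: real assume s: "0 < s" "s < 1"
  have u: "0 < (f ^^ n) s" "(f ^^ n) s < 1" for n using iterate_bounds[OF s, of n] s by auto
  let ?P = "\<lambda>n. \<Prod>j<n. B.F' ((f ^^ j) s)"
  \<comment> \<open>The product of \<open>B.Q\<close> along the orbit equals
    \<open>(1 - (f ^^ n) s) / (1 - s)\<close>, so only the squared product of derivatives
    survives.\<close>
  have pr: "(\<Prod>j<n. (B.F' ((f ^^ j) s))\<^sup>2 / B.Q ((f ^^ j) s)) * (1 - (f ^^ n) s) = (?P n)\<^sup>2 * (1 - s)" for n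
  proof (induction n)
    case (Suc n)
    let ?R = "\<Prod>j<n. (B.F' ((f ^^ j) s))\<^sup>2 / B.Q ((f ^^ j) s)"
    have "(\<Prod>j<Suc n. (B.F' ((f ^^ j) s))\<^sup>2 / B.Q ((f ^^ j) s)) * (1 - (f ^^ Suc n) s)
        = ?R * ((B.F' ((f ^^ n) s))\<^sup>2 / B.Q ((f ^^ n) s)) * ((1 - (f ^^ n) s) * B.Q ((f ^^ n) s))"
      using u[of n] by (simp add: f_eq)
    also have "\<dots> = (?R * (1 - (f ^^ n) s)) * (B.F' ((f ^^ n) s))\<^sup>2"
      using BQ_pos[OF u, of n] by simp
    also have "\<dots> = (?P (Suc n))\<^sup>2 * (1 - s)" unfolding Suc by (simp add: power_mult_distrib)
    finally show ?case .
  qed simp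
  have eq: "(\<Prod>j<n. (B.F' ((f ^^ j) s))\<^sup>2 / B.Q ((f ^^ j) s)) * ((1 - (f ^^ n) s) * X.G' ((f ^^ n) s))
      = (?P n)\<^sup>2 * (1 - s) * X.G' ((f ^^ n) s)" for n
    by (simp add: pr mult.assoc[symmetric])
  \<comment> \<open>Absolute values appear because the sign of \<open>X.G'\<close> is not
    controlled. The square of the telescoping bound provides the factor that
    \<open>X.G'_small\<close> asks for.\<close>
  have "(\<lambda>n. \<bar>(1 - (f ^^ n) s)\<^sup>2 * X.G' ((f ^^ n) s)\<bar> / (1 - s)) \<longlonglongrightarrow> \<bar>0\<bar> / (1 - s)"
    using s by (intro tendsto_intros filterlim_compose[OF X.G'_small iterate_at_left[OF s]]) auto
  then have lim: "(\<lambda>n. \<bar>(1 - (f ^^ n) s)\<^sup>2 * X.G' ((f ^^ n) s)\<bar> / (1 - s)) \<longlonglongrightarrow> 0" by simp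
  show "(\<lambda>n. (\<Prod>j<n. (B.F' ((f ^^ j) s))\<^sup>2 / B.Q ((f ^^ j) s)) * ((1 - (f ^^ n) s) * X.G' ((f ^^ n) s))) \<longlonglongrightarrow> 0"
    unfolding eq
  proof (rule Lim_null_comparison[OF always_eventually lim], rule allI)
    fix n
    have "(?P n)\<^sup>2 \<le> ((1 - (f ^^ n) s) / (1 - s))\<^sup>2"
      by (rule power_mono[OF prod_F'_le[OF s] prod_F'_nonneg[OF s]])
    then have "(?P n)\<^sup>2 * ((1 - s) * \<bar>X.G' ((f ^^ n) s)\<bar>) \<le> ((1 - (f ^^ n) s) / (1 - s))\<^sup>2
        * ((1 - s) * \<bar>X.G' ((f ^^ n) s)\<bar>)"
      using s by (intro mult_right_mono) auto
    also have "((1 - (f ^^ n) s) / (1 - s))\<^sup>2 * ((1 - s) * \<bar>X.G' ((f ^^ n) s)\<bar>)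
        = \<bar>(1 - (f ^^ n) s)\<^sup>2 * X.G' ((f ^^ n) s)\<bar> / (1 - s)"
      using s by (simp add: abs_mult power2_eq_square)
    finally show "norm ((?P n)\<^sup>2 * (1 - s) * X.G' ((f ^^ n) s)) \<le> \<bar>(1 - (f ^^ n) s)\<^sup>2
        * X.G' ((f ^^ n) s)\<bar> / (1 - s)"
      using s by (simp add: abs_mult mult.assoc)
  qed
qed (use b in auto)

text \<open>\<open>F'' = F * (G' + G^2)\<close> with a negligible square, so the limit passes from
  \<open>G'\<close> to \<open>F''\<close>, from there to \<open>Q'\<close>, and by monotonicity to
  the tails.\<close>

lemma tail_X: "(\<lambda>n. real n * X.tail n) \<longlonglongrightarrow> 1 / (1 - b)"
proof -
  obtain K where K: "0 < K" "eventually (\<lambda>s. X.G s \<le> K * ell s) (at_left 1)" by (rule XG_O_ell)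
  have "((\<lambda>s. X.F s * ((1 - s) * X.G' s + (1 - s) * (X.G s)\<^sup>2)) \<longlongrightarrow> 1 * (1 / (1 - b) + 0)) (at_left 1)"
    by (intro tendsto_intros X.F_tendsto_1 XG'_limit X.G_square_small[OF K(2)])
  then have "((\<lambda>s. X.F s * ((1 - s) * X.G' s + (1 - s) * (X.G s)\<^sup>2)) \<longlongrightarrow> 1 / (1 - b)) (at_left 1)" by simp
  then have "((\<lambda>s. (1 - s) * X.F'' s) \<longlongrightarrow> 1 / (1 - b)) (at_left 1)"
  proof (rule Lim_transform_eventually)
    show "eventually (\<lambda>s. X.F s * ((1 - s) * X.G' s + (1 - s) * (X.G s)\<^sup>2) = (1 - s) * X.F'' s) (at_left 1)"
      using eventually_at_left_one
    proof eventually_elim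
      case (elim s)
      then have "X.F s > 0" using X.F_pos by auto
      then show ?case by (simp add: X.G'_def X.G_def distrib_left[symmetric])
    qed
  qed
  from X.Q'_tendsto[OF this] show ?thesis
    by (rule monotone_tauberian[OF X.decseq_tail X.tail_nonneg X.unit_summable_tail])
qed

end

section \<open>Generating functions of random variables\<close>

definition point_mass :: "'a measure \<Rightarrow> ('a \<Rightarrow> nat) \<Rightarrow> nat \<Rightarrow> real" where
  "point_mass M Y n = measure (distr M (count_space UNIV) Y) {n}"

context prob_space
begin

lemma prob_seq_point_mass:
  assumes Y: "Y \<in> measurable M (count_space UNIV)"
  shows "prob_seq (point_mass M Y)"
proof
  interpret D: prob_space "distr M (count_space UNIV) Y" using Y by (rule prob_space_distr)
  show "0 \<le> point_mass M Y n" for n by (simp add: point_mass_def)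
  have "(\<lambda>n. measure (distr M (count_space UNIV) Y) {n}) sums measure (distr M (count_space UNIV) Y)
      (\<Union>n. {n})"
    by (rule D.finite_measure_UNION) (auto simp: disjoint_family_on_def)
  moreover have "(\<Union>n::nat. {n}) = space (distr M (count_space UNIV) Y)" by auto
  ultimately show "point_mass M Y sums 1" by (simp only: point_mass_def[abs_def] D.prob_space)
qed

lemma tail_point_mass:
  assumes Y: "Y \<in> measurable M (count_space UNIV)"
  shows "prob_seq.tail (point_mass M Y) n = measure M {\<omega> \<in> space M. n < Y \<omega>}"
proof -
  interpret D: prob_space "distr M (count_space UNIV) Y" using Y by (rule prob_space_distr)
  let ?D = "distr M (count_space UNIV) Y"
  have "(\<Sum>k\<le>n. point_mass M Y k) = measure ?D {..n}"
    unfolding point_mass_def by (rule D.finite_measure_eq_sum_singleton[symmetric]) auto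
  then have "prob_seq.tail (point_mass M Y) n = 1 - measure ?D {..n}"
    by (simp add: prob_seq.tail_def[OF prob_seq_point_mass[OF Y]])
  also have "\<dots> = measure ?D (space ?D - {..n})" by (rule D.prob_compl[symmetric]) simp
  also have "space ?D - {..n} = {n<..}" by auto
  also have "measure ?D {n<..} = measure M {\<omega> \<in> space M. n < Y \<omega>}"
    using Y by (subst measure_distr) (auto intro!: arg_cong[where f = "measure M"])
  finally show ?thesis .
qed

text \<open>The endpoint 1 is included because the formula is also applied at a value of another
  generating function, known there only to lie between 0 and 1.\<close>

lemma gf_point_mass:
  assumes Y: "Y \<in> measurable M (count_space UNIV)" and s: "0 \<le> s" "s \<le> 1"
  shows "gf (point_mass M Y) s = (\<integral>\<omega>. s ^ Y \<omega> \<partial>M)"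
proof -
  interpret P: prob_seq "point_mass M Y" using Y by (rule prob_seq_point_mass)
  let ?D = "distr M (count_space UNIV) Y"
  interpret D: prob_space ?D using Y by (rule prob_space_distr)
  have D: "?D = density (count_space UNIV) (\<lambda>n. ennreal (point_mass M Y n))"
  proof (rule measure_eqI_countable[of _ UNIV])
    fix n
    show "emeasure ?D {n} = emeasure (density (count_space UNIV) (\<lambda>n. ennreal (point_mass M Y n))) {n}"
      by (simp add: emeasure_density nn_integral_indicator_singleton point_mass_def D.emeasure_eq_measure)
  qed auto
  have "summable (point_mass M Y)" using P.sums_1 by (rule sums_summable)
  then have "summable (\<lambda>n. point_mass M Y n * s ^ n)"
    by (rule summable_comparison_test'[of _ 0])
      (use s P.nonneg in \<open>auto simp: abs_mult power_abs intro!: mult_left_le power_le_one\<close>)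
  then have int: "integrable (count_space UNIV) (\<lambda>n. point_mass M Y n * s ^ n)"
    using s P.nonneg by (simp add: integrable_count_space_nat_iff abs_mult)
  have "(\<integral>\<omega>. s ^ Y \<omega> \<partial>M) = (\<integral>n. s ^ n \<partial>?D)" using Y by (subst integral_distr) auto
  also have "\<dots> = (\<integral>n. point_mass M Y n * s ^ n \<partial>count_space UNIV)"
    unfolding D by (subst integral_density) (auto simp: P.nonneg)
  also have "\<dots> = gf (point_mass M Y) s" unfolding gf_def by (rule integral_count_space_nat[OF int])
  finally show ?thesis by simp
qed

lemma tail_sums_expectation:
  assumes Y: "Y \<in> measurable M (count_space UNIV)" and int: "integrable M (\<lambda>\<omega>. real (Y \<omega>))"
  shows "prob_seq.tail (point_mass M Y) sums (\<integral>\<omega>. real (Y \<omega>) \<partial>M)"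
proof -
  interpret P: prob_seq "point_mass M Y" using Y by (rule prob_seq_point_mass)
  have "ennreal (\<integral>\<omega>. real (Y \<omega>) \<partial>M) = (\<integral>\<^sup>+\<omega>. ennreal (real (Y \<omega>)) \<partial>M)"
    using int by (simp add: nn_integral_eq_integral)
  also have "\<dots> = (\<Sum>t. emeasure M {\<omega> \<in> space M. t < Y \<omega>})"
    using nn_integral_nat_function[OF Y] by (simp add: ennreal_of_nat_eq_real_of_nat)
  also have "\<dots> = (\<Sum>t. ennreal (P.tail t))"
    by (simp add: tail_point_mass[OF Y] emeasure_eq_measure)
  finally have "(\<Sum>t. ennreal (P.tail t)) = ennreal (\<integral>\<omega>. real (Y \<omega>) \<partial>M)" by simp
  moreover have "(\<lambda>t. ennreal (P.tail t)) sums (\<Sum>t. ennreal (P.tail t))" by (rule summable_sums) simp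
  ultimately have "(\<lambda>t. ennreal (P.tail t)) sums ennreal (\<integral>\<omega>. real (Y \<omega>) \<partial>M)" by simp
  then show ?thesis by (subst (asm) sums_ennreal) (auto simp: P.tail_nonneg)
qed

text \<open>Independence factorizes the expectation of a product. In \<open>case_nat A Bs\<close>
  index 0 is \<open>A\<close> and index \<open>Suc i\<close> is \<open>Bs i\<close>, so the indices
  up to \<open>k\<close> are \<open>A\<close> and the first \<open>k\<close> summands.\<close>

lemma expectation_power_sum:
  assumes A: "A \<in> measurable M (count_space UNIV)" and B: "B \<in> measurable M (count_space UNIV)"
    and Bs: "\<And>i. distr M (count_space UNIV) (Bs i) = distr M (count_space UNIV) B"
    and indep: "indep_vars (\<lambda>_. count_space UNIV) (case_nat A Bs) UNIV"
    and s: "0 \<le> s" "s \<le> 1"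
  shows "(\<integral>\<omega>. s ^ (A \<omega> + (\<Sum>i<k. Bs i \<omega>)) \<partial>M) = gf (point_mass M A) s * gf (point_mass M B) s ^ k"
proof -
  have meas: "Bs i \<in> measurable M (count_space UNIV)" for i
  proof -
    have "case_nat A Bs (Suc i) \<in> measurable M (count_space UNIV)"
        using indep unfolding indep_vars_def2 by blast
    then show ?thesis by simp
  qed
  let ?Y = "case_nat A Bs"
  have Y: "?Y i \<in> measurable M (count_space UNIV)" for i using A meas by (cases i) auto
  have "indep_vars (\<lambda>_. borel) (\<lambda>i \<omega>. s ^ ?Y i \<omega>) {..k}"
    by (rule indep_vars_compose2[where Y = "\<lambda>_ n. s ^ n", OF indep_vars_subset[OF indep]]) auto
  moreover have "integrable M (\<lambda>\<omega>. s ^ ?Y i \<omega>)" for i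
    by (rule integrable_const_bound[of _ 1]) (use s Y in \<open>auto intro: power_le_one\<close>)
  ultimately have "(\<integral>\<omega>. (\<Prod>i\<le>k. s ^ ?Y i \<omega>) \<partial>M) = (\<Prod>i\<le>k. \<integral>\<omega>. s ^ ?Y i \<omega> \<partial>M)"
    by (intro indep_vars_lebesgue_integral) auto
  also have "\<dots> = (\<integral>\<omega>. s ^ A \<omega> \<partial>M) * (\<Prod>i<k. \<integral>\<omega>. s ^ Bs i \<omega> \<partial>M)"
    by (subst lessThan_Suc_atMost[symmetric], subst prod.lessThan_Suc_shift) simp
  also have "\<dots> = gf (point_mass M A) s * gf (point_mass M B) s ^ k"
    by (simp add: gf_point_mass[OF _ s, symmetric] A meas) (simp add: point_mass_def[abs_def] Bs)
  also have "(\<lambda>\<omega>. \<Prod>i\<le>k. s ^ ?Y i \<omega>) = (\<lambda>\<omega>. s ^ (A \<omega> + (\<Sum>i<k. Bs i \<omega>)))"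
    by (subst lessThan_Suc_atMost[symmetric], subst prod.lessThan_Suc_shift) (simp add: power_add power_sum)
  finally show ?thesis .
qed

end

text \<open>Fubini conditions on \<open>X\<close>: for a fixed outcome the number of summands is
  constant and the inner expectation is a power, whose integral is the generating function of
  \<open>X\<close> at the base of that power.\<close>

lemma stationary_gf:
  assumes "prob_space M" "stationary_solution M A Bs N X"
    and A: "A \<in> measurable M (count_space UNIV)" and B: "B \<in> measurable M (count_space UNIV)"
    and Bs: "\<And>i. distr M (count_space UNIV) (Bs i) = distr M (count_space UNIV) B"
    and indep: "prob_space.indep_vars M (\<lambda>_. count_space UNIV) (case_nat A Bs) UNIV"
    and s: "0 < s" "s < 1"
  shows "gf (point_mass N X) s = gf (point_mass M A) s * gf (point_mass N X) (gf (point_mass M B) s)"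
proof -
  interpret M: prob_space M by fact
  interpret N: prob_space N using assms(2) by (simp add: stationary_solution_def)
  interpret NM: pair_prob_space N M ..
  interpret PB: prob_seq "point_mass M B" using B by (rule M.prob_seq_point_mass)
  have X[measurable]: "X \<in> measurable N (count_space UNIV)"
    and eq: "distr N (count_space UNIV) X =
       distr (N \<Otimes>\<^sub>M M) (count_space UNIV) (\<lambda>(\<eta>, \<omega>). A \<omega> + (\<Sum>i<X \<eta>. Bs i \<omega>))"
    using assms(2) by (simp_all add: stationary_solution_def)
  note A[measurable]
  have meas[measurable]: "Bs i \<in> measurable M (count_space UNIV)" for i
  proof -
    have "case_nat A Bs (Suc i) \<in> measurable M (count_space UNIV)"
      using indep unfolding M.indep_vars_def2 by blast
    then show ?thesis by simp
  qed
  let ?Y = "\<lambda>z. A (snd z) + (\<Sum>i<X (fst z). Bs i (snd z))"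
  \<comment> \<open>The number of summands is random; measurability is checked for each of its
    countably many values.\<close>
  have Y: "?Y \<in> measurable (N \<Otimes>\<^sub>M M) (count_space UNIV)"
  proof (rule measurable_compose_countable[where f = "\<lambda>k z. A (snd z) + (\<Sum>i<k. Bs i (snd z))"])
    fix k show "(\<lambda>z. A (snd z) + (\<Sum>i<k. Bs i (snd z))) \<in> measurable (N \<Otimes>\<^sub>M M) (count_space UNIV)"
      by measurable
  qed measurable
  have "gf (point_mass N X) s = gf (point_mass (N \<Otimes>\<^sub>M M) ?Y) s"
    unfolding point_mass_def eq by (simp add: split_beta')
  also have "\<dots> = (\<integral>z. s ^ ?Y z \<partial>(N \<Otimes>\<^sub>M M))"
    using s by (intro NM.P.gf_point_mass Y) auto
  also have "\<dots> = (\<integral>\<eta>. \<integral>\<omega>. s ^ ?Y (\<eta>, \<omega>) \<partial>M \<partial>N)"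
  proof (rule NM.integral_fst'[symmetric])
    have "norm (s ^ ?Y z) \<le> 1" for z using s power_le_one[of s "?Y z"] by simp
    moreover have "(\<lambda>z. s ^ ?Y z) \<in> borel_measurable (N \<Otimes>\<^sub>M M)" by (rule measurable_compose[OF Y]) simp
    ultimately show "integrable (N \<Otimes>\<^sub>M M) (\<lambda>z. s ^ ?Y z)"
      by (intro NM.P.integrable_const_bound[of _ 1] AE_I2)
  qed
  also have "\<dots> = (\<integral>\<eta>. gf (point_mass M A) s * gf (point_mass M B) s ^ X \<eta> \<partial>N)"
    using s M.expectation_power_sum[OF A B Bs indep, of s] by simp
  also have "\<dots> = gf (point_mass M A) s * (\<integral>\<eta>. gf (point_mass M B) s ^ X \<eta> \<partial>N)" by simp
  also have "\<dots> = gf (point_mass M A) s * gf (point_mass N X) (gf (point_mass M B) s)"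
    using s PB.gf_nonnegs(1)[of s] PB.F_le_1[of s] by (simp add: N.gf_point_mass[OF X])
  finally show ?thesis .
qed

section \<open>Tail asymptotics of the stationary solution\<close>

text \<open>\<open>ln (x * b powi (- n)) = ln x - n * ln b\<close> separates the part growing with
  \<open>x\<close> from a constant; both sums are reindexed to start at 0.\<close>

lemma correction_term_eq:
  assumes b: "0 < b" "b < 1" and x: "x > 0"
  shows "correction_term b L x =
    (ln x * (\<Sum>n. real (Suc n) * b ^ n) - ln b * (\<Sum>n. real (Suc n) * real (Suc n) * b ^ n))
        * (L x / (1 + x))"
proof -
  have b1: "\<bar>b\<bar> < 1" using b by simp
  have s1: "summable (\<lambda>n. real (Suc n) * b ^ n)"
    by (rule unit_summableD[OF unit_summable_Suc b1])
  have "unit_summable (\<lambda>n. real (Suc n) * real (Suc (Suc n)))"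
    using unit_summable_diffs[OF unit_summable_Suc] by (simp add: diffs_def[abs_def] mult_ac)
  then have "unit_summable (\<lambda>n. real (Suc n) * real (Suc n))"
    by (rule unit_summable_le) (auto intro!: mult_left_mono simp: abs_mult)
  then have s2: "summable (\<lambda>n. real (Suc n) * real (Suc n) * b ^ n)"
    by (rule unit_summableD[OF _ b1])
  define g where "g n = real (Suc n) * b ^ n * ln (x * b powi (- int (Suc n)))" for n
  have ln_eq: "ln (x * b powi (- int m)) = ln x - real m * ln b" for m
    using b x by (simp add: power_int_minus ln_mult ln_inverse ln_realpow)
  have g: "g n = ln x * (real (Suc n) * b ^ n) + (- ln b) * (real (Suc n) * real (Suc n) * b ^ n)" for n
    unfolding g_def ln_eq by (simp add: algebra_simps)
  have sm: "(\<lambda>n. g n) sums (ln x * (\<Sum>n. real (Suc n) * b ^ n) + (- ln b) * (\<Sum>n. real (Suc n)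
      * real (Suc n) * b ^ n))"
    unfolding g by (intro sums_add sums_mult summable_sums s1 s2)
  \<comment> \<open>\<open>infsum\<close> is unconditional summation; absolute convergence is what
    identifies it with the ordinary series.\<close>
  have "summable (\<lambda>n. norm (g n))"
  proof (rule summable_comparison_test'[where N = 0])
    show "summable (\<lambda>n. \<bar>ln x\<bar> * (real (Suc n) * b ^ n) + \<bar>ln b\<bar> * (real (Suc n) * real (Suc n) * b ^ n))"
      by (intro summable_add summable_mult s1 s2)
    show "norm (norm (g n)) \<le> \<bar>ln x\<bar> * (real (Suc n) * b ^ n) + \<bar>ln b\<bar> * (real (Suc n)
        * real (Suc n) * b ^ n)" for n
      unfolding g using abs_triangle_ineq[of "ln x * (real (Suc n) * b ^ n)" "(- ln b)
          * (real (Suc n) * real (Suc n) * b ^ n)"] b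
      by (simp add: abs_mult)
  qed
  then have "(g has_sum (ln x * (\<Sum>n. real (Suc n) * b ^ n) + (- ln b) * (\<Sum>n. real (Suc n)
      * real (Suc n) * b ^ n))) UNIV"
    by (rule norm_summable_imp_has_sum[OF _ sm])
  then have "infsum g UNIV = ln x * (\<Sum>n. real (Suc n) * b ^ n) - ln b * (\<Sum>n. real (Suc n)
      * real (Suc n) * b ^ n)"
    by (simp add: infsumI)
  moreover have "(\<Sum>\<^sub>\<infinity>n\<in>{1::nat..}. real n * b ^ (n - 1) * ln (x * b powi (- int n))) = infsum g UNIV"
  proof (rule infsum_reindex_bij_betw[symmetric, where g = Suc, THEN trans])
    show "bij_betw Suc UNIV {1..}"
      by (rule bij_betwI[of _ _ _ "\<lambda>n. n - 1"]) auto
  qed (simp add: g_def[abs_def])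
  ultimately show ?thesis by (simp add: correction_term_def)
qed

text \<open>The coefficient of \<open>ln x\<close> is \<open>1 / (1 - b)^2\<close>, which is
  positive, and the other series does not depend on \<open>x\<close>.\<close>

lemma correction_term_bigtheta:
  assumes b: "0 < b" "b < 1"
  shows "correction_term b L \<in> \<Theta>[at_top](\<lambda>x. L x * ln x / (1 + x))"
proof -
  define S where "S = (\<Sum>n. real (Suc n) * b ^ n)"
  define T where "T = ln b * (\<Sum>n. real (Suc n) * real (Suc n) * b ^ n)"
  have "S = 1 / (1 - b)\<^sup>2" unfolding S_def using geometric_deriv_sums[of b] b by (auto dest: sums_unique)
  then have S: "S > 0" using b by simp
  have "eventually (\<lambda>x. correction_term b L x = (ln x * S - T) * (L x / (1 + x))) at_top"
    using eventually_gt_at_top[of 0] by eventually_elim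
        (use b in \<open>simp add: correction_term_eq S_def T_def\<close>)
  then have "correction_term b L \<in> \<Theta>[at_top](\<lambda>x. (ln x * S - T) * (L x / (1 + x)))"
    by (rule bigthetaI_cong)
  also have "(\<lambda>x. (ln x * S - T) * (L x / (1 + x))) \<in> \<Theta>[at_top](\<lambda>x. ln x * (L x / (1 + x)))"
  proof (rule landau_theta.mult)
    have "((\<lambda>x. (ln x * S - T) / ln x) \<longlongrightarrow> S) at_top" by real_asymp
    then show "(\<lambda>x. ln x * S - T) \<in> \<Theta>(\<lambda>x. ln x)"
      using S by (intro bigthetaI_tendsto) auto
  qed simp
  finally show ?thesis by (simp add: mult_ac)
qed

text \<open>Replacing \<open>L\<close> by its equivalent leaves essentially
  \<open>ln x powr (- \<epsilon>)\<close>. The variant with \<open>x + 1\<close> fits the shifted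
  index in \<open>log_B\<close>, the other one the size of the correction term.\<close>

lemma L_ln_tendsto_0:
  fixes L :: "real \<Rightarrow> real"
  assumes "\<epsilon> > 0" "L \<sim>[at_top] (\<lambda>x. ln x powr (- 1 - \<epsilon>))"
  shows "((\<lambda>x. L x * ln (x + 1)) \<longlongrightarrow> 0) at_top" and "((\<lambda>x. L x * ln x) \<longlongrightarrow> 0) at_top"
proof -
  have ne: "eventually (\<lambda>x::real. ln x powr (- 1 - \<epsilon>) \<noteq> 0) at_top"
    using eventually_gt_at_top[of 1] by eventually_elim auto
  then have r: "((\<lambda>x. L x / ln x powr (- 1 - \<epsilon>)) \<longlongrightarrow> 1) at_top"
    by (intro asymp_equivD_strong[OF assms(2)]) (auto elim: eventually_mono)
  have "((\<lambda>x::real. ln x powr (- 1 - \<epsilon>) * ln (x + 1)) \<longlongrightarrow> 0) at_top"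
    using assms(1) by real_asymp
  with r have "((\<lambda>x. L x / ln x powr (- 1 - \<epsilon>) * (ln x powr (- 1 - \<epsilon>) * ln (x + 1))) \<longlongrightarrow> 0) at_top"
    by (rule tendsto_mult[THEN tendsto_eq_rhs]) simp
  then show "((\<lambda>x. L x * ln (x + 1)) \<longlongrightarrow> 0) at_top"
    by (rule Lim_transform_eventually) (use ne in \<open>auto elim!: eventually_mono\<close>)
  have "((\<lambda>x::real. ln x powr (- 1 - \<epsilon>) * ln x) \<longlongrightarrow> 0) at_top"
    using assms(1) by real_asymp
  with r have "((\<lambda>x. L x / ln x powr (- 1 - \<epsilon>) * (ln x powr (- 1 - \<epsilon>) * ln x)) \<longlongrightarrow> 0) at_top"
    by (rule tendsto_mult[THEN tendsto_eq_rhs]) simp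
  then show "((\<lambda>x. L x * ln x) \<longlongrightarrow> 0) at_top"
    by (rule Lim_transform_eventually) (use ne in \<open>auto elim!: eventually_mono\<close>)
qed

text \<open>Tails of an integer variable are constant between consecutive integers, and
  \<open>(1 + x) / \<lfloor>x\<rfloor>\<close> tends to 1.\<close>

lemma tail_at_real:
  fixes t :: "nat \<Rightarrow> real" and T :: "real \<Rightarrow> real"
  assumes t: "(\<lambda>n. real n * t n) \<longlonglongrightarrow> c" and T: "\<And>x. x \<ge> 0 \<Longrightarrow> T x = t (nat \<lfloor>x\<rfloor>)"
  shows "((\<lambda>x. T x / (1 / (1 + x))) \<longlongrightarrow> c) at_top"
proof -
  have "filterlim (\<lambda>x::real. nat \<lfloor>x\<rfloor>) sequentially at_top" by real_asymp
  from filterlim_compose[OF t this]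
  have 1: "((\<lambda>x::real. real (nat \<lfloor>x\<rfloor>) * t (nat \<lfloor>x\<rfloor>)) \<longlongrightarrow> c) at_top" .
  have "((\<lambda>x::real. (1 + x) / real (nat \<lfloor>x\<rfloor>)) \<longlongrightarrow> 1) at_top" by real_asymp
  from tendsto_mult[OF this 1]
  have "((\<lambda>x. (1 + x) / real (nat \<lfloor>x\<rfloor>) * (real (nat \<lfloor>x\<rfloor>) * t (nat \<lfloor>x\<rfloor>))) \<longlongrightarrow> c) at_top" by simp
  then show ?thesis
  proof (rule Lim_transform_eventually)
    show "eventually (\<lambda>x. (1 + x) / real (nat \<lfloor>x\<rfloor>) * (real (nat \<lfloor>x\<rfloor>) * t (nat \<lfloor>x\<rfloor>)) = T x / (1 / (1
        + x))) at_top"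
      using eventually_ge_at_top[of 1]
    proof eventually_elim
      case (elim x)
      then have "1 \<le> \<lfloor>x\<rfloor>" by simp
      then have "real (nat \<lfloor>x\<rfloor>) \<noteq> 0" by linarith
      then show ?case using elim by (simp add: T)
    qed
  qed
qed

theorem theorem1p1:
  fixes M :: "'a measure" and A B :: "'a \<Rightarrow> nat" and Bs :: "nat \<Rightarrow> 'a \<Rightarrow> nat"
    and N :: "'b measure" and X :: "'b \<Rightarrow> nat"
    and L :: "real \<Rightarrow> real" and \<epsilon> b :: real
  assumes "prob_space M"
    and "A \<in> measurable M (count_space UNIV)"
    and "B \<in> measurable M (count_space UNIV)"
    and "\<And>i. distr M (count_space UNIV) (Bs i) = distr M (count_space UNIV) B"
    and "prob_space.indep_vars M (\<lambda>_. count_space UNIV) (case_nat A Bs) UNIV"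
    and "(\<lambda>x. measure M {\<omega> \<in> space M. real (A \<omega>) > x}) \<sim>[at_top] (\<lambda>x. inverse (1 + x))"
    and "slowly_varying L"
    and "\<And>x. x > 0 \<Longrightarrow> measure M {\<omega> \<in> space M. real (B \<omega>) > x} = L x / (1 + x)"
    and "\<epsilon> > 0"
    and "L \<sim>[at_top] (\<lambda>x. ln x powr (- 1 - \<epsilon>))"
    and "b = (\<integral>\<omega>. real (B \<omega>) \<partial>M)"
    and "0 < b" and "b < 1"
    and "stationary_solution M A Bs N X"
  shows "(\<exists>r \<in> o[at_top](\<lambda>_. 1).
            (\<lambda>x. measure N {\<eta> \<in> space N. real (X \<eta>) > x}) \<sim>[at_top]
              (\<lambda>x. 1 / ((1 - b) * (1 + x)) + correction_term b L x * (1 + r x))) \<and>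
         (\<lambda>x. measure N {\<eta> \<in> space N. real (X \<eta>) > x}) \<sim>[at_top]
           (\<lambda>x. 1 / ((1 - b) * (1 + x))) \<and>
         correction_term b L \<in> \<Theta>[at_top](\<lambda>x. L x * ln x / (1 + x)) \<and>
         (\<lambda>x. L x * ln x / (1 + x)) \<in> o[at_top](\<lambda>x. 1 / (1 + x))"
proof -
  interpret M: prob_space M by fact
  have N: "prob_space N" and X: "X \<in> measurable N (count_space UNIV)"
    using assms(14) by (simp_all add: stationary_solution_def)
  interpret N: prob_space N by fact
  interpret A: prob_seq "point_mass M A" by (rule M.prob_seq_point_mass) fact
  interpret B: prob_seq "point_mass M B" by (rule M.prob_seq_point_mass) fact
  interpret X: prob_seq "point_mass N X" by (rule N.prob_seq_point_mass[OF X])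
  note tA = M.tail_point_mass[OF assms(2)] and tB = M.tail_point_mass[OF assms(3)]
    and tX = N.tail_point_mass[OF X]
  \<comment> \<open>The Bochner integral of a non-integrable function is 0, so \<open>0 < b\<close>
    forces integrability.\<close>
  have intB: "integrable M (\<lambda>\<omega>. real (B \<omega>))"
    using assms(11,12) not_integrable_integral_eq by force
  interpret stationary_pgf "point_mass M A" "point_mass M B" "point_mass N X" b
  proof
    show "gf (point_mass N X) s = gf (point_mass M A) s * gf (point_mass N X) (gf (point_mass M B) s)"
      if "0 < s" "s < 1" for s
      by (rule stationary_gf[OF assms(1,14,2-5) that])
    show "B.tail sums b" unfolding assms(11) by (rule M.tail_sums_expectation[OF assms(3) intB])
    show "0 < b" "b < 1" by fact+
    have "((\<lambda>x. measure M {\<omega> \<in> space M. real (A \<omega>) > x} / inverse (1 + x)) \<longlongrightarrow> 1) at_top"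
      by (rule asymp_equivD_strong[OF assms(6)]) (use eventually_gt_at_top[of 0] in eventually_elim, auto)
    from filterlim_compose[OF this filterlim_real_sequentially]
    have "(\<lambda>n. A.tail n * (1 + real n)) \<longlonglongrightarrow> 1" by (simp add: tA divide_inverse)
    moreover have "(\<lambda>n. real n / (1 + real n)) \<longlonglongrightarrow> 1" by real_asymp
    ultimately have "(\<lambda>n. A.tail n * (1 + real n) * (real n / (1 + real n))) \<longlonglongrightarrow> 1 * 1"
      by (intro tendsto_mult)
    moreover have "A.tail n * (1 + real n) * (real n / (1 + real n)) = real n * A.tail n" for n
      by (simp add: field_simps)
    ultimately show "(\<lambda>n. real n * A.tail n) \<longlonglongrightarrow> 1" by (simp add: mult.commute)
    \<comment> \<open>Hence \<open>(n + 1) * B.tail (n + 1)\<close> is \<open>L (n + 1)\<close> up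
      to the factor \<open>(n + 1) / (n + 2)\<close>, which tends to 1.\<close>
    have BT: "B.tail (Suc n) = L (real (Suc n)) / (1 + real (Suc n))" for n
      using assms(8)[of "real (Suc n)"] by (simp add: tB del: of_nat_Suc)
    have "filterlim (\<lambda>n. real (Suc n)) at_top sequentially" by real_asymp
    from filterlim_compose[OF L_ln_tendsto_0(1)[OF assms(9,10)] this]
    have "(\<lambda>n. L (real (Suc n)) * ln (real (Suc n) + 1)) \<longlonglongrightarrow> 0" .
    moreover have "(\<lambda>n. real (Suc n) / (1 + real (Suc n))) \<longlonglongrightarrow> 1" by real_asymp
    ultimately have "(\<lambda>n. L (real (Suc n)) * ln (real (Suc n) + 1) * (real (Suc n) / (1
        + real (Suc n)))) \<longlonglongrightarrow> 0 * 1"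
      by (intro tendsto_mult)
    then show "(\<lambda>n. real (Suc n) * B.tail (Suc n) * ln (real (n + 2))) \<longlonglongrightarrow> 0"
      by (simp add: BT mult_ac add_ac)
  qed
  let ?T = "\<lambda>x. measure N {\<eta> \<in> space N. real (X \<eta>) > x}"
  have "((\<lambda>x. ?T x / (1 / (1 + x))) \<longlongrightarrow> 1 / (1 - b)) at_top"
  proof (rule tail_at_real[OF tail_X])
    fix x :: real assume "x \<ge> 0"
    then have "x < real k \<longleftrightarrow> nat \<lfloor>x\<rfloor> < k" for k by linarith
    then show "?T x = X.tail (nat \<lfloor>x\<rfloor>)" by (simp add: tX)
  qed
  then have main: "?T \<sim>[at_top] (\<lambda>x. 1 / ((1 - b) * (1 + x)))"
    using asymp_equivI'_const[of ?T "\<lambda>x. 1 / (1 + x)" "1 / (1 - b)" at_top] b by simp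
  have small: "(\<lambda>x. L x * ln x / (1 + x)) \<in> o[at_top](\<lambda>x. 1 / (1 + x))"
  proof (rule smalloI_tendsto)
    show "((\<lambda>x. L x * ln x / (1 + x) / (1 / (1 + x))) \<longlongrightarrow> 0) at_top"
      by (rule Lim_transform_eventually[OF L_ln_tendsto_0(2)[OF assms(9,10)]])
        (use eventually_gt_at_top[of 0] in eventually_elim, auto)
    show "eventually (\<lambda>x::real. 1 / (1 + x) \<noteq> 0) at_top"
      using eventually_gt_at_top[of 0] by eventually_elim auto
  qed
  have theta: "correction_term b L \<in> \<Theta>[at_top](\<lambda>x. L x * ln x / (1 + x))"
    by (rule correction_term_bigtheta[OF b])
  have "correction_term b L \<in> o[at_top](\<lambda>x. 1 / (1 + x))"
    using landau_o.big_small_trans[OF bigthetaD1[OF theta] small] .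
  also have "(\<lambda>x::real. 1 / (1 + x)) \<in> O[at_top](\<lambda>x. 1 / ((1 - b) * (1 + x)))"
    by (rule bigoI[where c = "1 - b"]) (use b in \<open>simp add: abs_mult\<close>)
  finally have "correction_term b L \<in> o[at_top](\<lambda>x. 1 / ((1 - b) * (1 + x)))" .
  then have "(\<lambda>x. 1 / ((1 - b) * (1 + x)) + correction_term b L x) \<sim>[at_top] (\<lambda>x. 1 / ((1 - b) * (1 + x)))"
    by (simp add: asymp_equiv_add_right)
  then have "?T \<sim>[at_top] (\<lambda>x. 1 / ((1 - b) * (1 + x)) + correction_term b L x)"
    using main asymp_equiv_trans asymp_equiv_symI by blast
  then have "\<exists>r \<in> o[at_top](\<lambda>_. 1). ?T \<sim>[at_top] (\<lambda>x. 1 / ((1 - b) * (1 + x))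
      + correction_term b L x * (1 + r x))"
    by (intro bexI[of _ "\<lambda>_. 0"]) auto
  with main theta small show ?thesis by blast
qed

end
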